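(* Let $D$ be a non-negative random variable with finite mean and strictly positive variance, and let $h,p>0$. With $\mathrm{OPT}(L)$, $\pi_r$, $C(\pi_r)$, $r_\infty$, $\gamma$, $\vartheta$, $g$ as defined in the context, for every integer $L\ge 1$, $$\frac{C(\pi_{r_\infty})}{\mathrm{OPT}(L)}\ \le\ 1+h\big((1-\gamma)g\big)^{-1}\Big(\mathbb{E}[D]-r_\infty+\big(e\,\vartheta\,(L+1)\big)^{-1}\Big)\gamma^{L+1}.$$
   Context: Lost-sales inventory model. $\{D_t\}_{t\ge1}$ are i.i.d. demands distributed as $D$; $L\ge1$ is an integer lead time; $h>0$ and $p>0$ are the unit holding cost and the unit lost-sales penalty. At the start of period $t$ the state is the on-hand inventory $I_t\ge 0$ and the pipeline vector $\mathbf{x}_t=(x_{1,t},\dots,x_{L,t})\in[0,\infty)^L$, with initial conditions $I_1=0$, $\mathbf{x}_1=\mathbf{0}$. An admissible policy $\pi\in\Pi$ is a sequence of deterministic measurable functions $f^\pi_t:[0,\infty)^{L+1}\to[0,\infty)$, $t\ge1$; in period $t$ the quantity $x_{1,t}$ is delivered, the order $f^\pi_t(\mathbf{x}_t,I_t)$ is placed, and then $D_t$ is realized. The dynamics are $I_{t+1}=\max(0,I_t+x_{1,t}-D_t)$, $x_{i,t+1}=x_{i+1,t}$ for $1\le i\le L-1$, and $x_{L,t+1}=f^\pi_t(\mathbf{x}_t,I_t)$. The cost in period $t$ is $C^\pi_t=h(I_t+x_{1,t}-D_t)^++p(I_t+x_{1,t}-D_t)^-$, where $x^+=\max(x,0)$,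 $x^-=\max(-x,0)$. The long-run average cost is $C(\pi)=\limsup_{T\to\infty}\frac1T\sum_{t=1}^T\mathbb{E}[C^\pi_t]$, and $\mathrm{OPT}(L)=\inf_{\pi\in\Pi}C(\pi)$. Constant-order policies. For $r\in[0,\mathbb{E}[D])$, $\pi_r$ is the policy that orders $r$ in every period. It is well known that, independently of $L$, $$C(\pi_r)=h\,\mathbb{E}\Big[\sup_{j\ge0}\Big(jr-\sum_{i=1}^jD_i\Big)\Big]+p\,\mathbb{E}[D]-pr ,$$ which is finite and convex in $r$ on $[0,\mathbb{E}[D])$ and tends to $\infty$ as $r\uparrow\mathbb{E}[D]$ (set it to $+\infty$ at $r=\mathbb{E}[D]$). $r_\infty$ denotes the infimum of the set of minimizers of $r\mapsto C(\pi_r)$ over $[0,\mathbb{E}[D]]$; it is itself a minimizer and $r_\infty<\mathbb{E}[D]$. Other quantities. For $\theta\ge0$, $\phi(\theta)=\exp(\theta r_\infty)\,\mathbb{E}[\exp(-\theta D)]$; $\gamma=\inf_{\theta\ge0}\phi(\theta)$, which lies in $[0,1)$; $\vartheta$ is the supremum of the set of minimizers of $\phi$ over $[0,\infty)$, with $\vartheta=\infty$ if the infimum is not attained (one has $\vartheta>0$). $g=\inf_{x\in\mathbb{R}}\mathbb{E}[h(x-D)^++p(x-D)^-]>0$. Convention: $1/\infty=0$; $e$ is Euler's number. Empty sums equal $0$. *)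

theory Defs
  imports "HOL-Probability.Probability"
begin

text \<open>
  A state is a pair \<open>(x, I)\<close> of a pipeline vector \<open>x\<close>, represented as an extensional function on
  \<open>{1..L}\<close>, and an on-hand inventory \<open>I\<close>. Demands are \<open>d t\<close> for \<open>t \<ge> 1\<close>.
\<close>

definition state_space :: "nat \<Rightarrow> ((nat \<Rightarrow> real) \<times> real) measure" where
  "state_space L =
     (\<Pi>\<^sub>M i\<in>{1..L}. restrict_space borel {0..}) \<Otimes>\<^sub>M restrict_space borel {0..}"

type_synonym policy = "nat \<Rightarrow> (nat \<Rightarrow> real) \<times> real \<Rightarrow> real"

definition admissible :: "nat \<Rightarrow> policy set" where
  "admissible L = {f. \<forall>t\<ge>1. f t \<in> state_space L \<rightarrow>\<^sub>M restrict_space borel {0..}}"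

definition constant_order :: "real \<Rightarrow> policy" where
  "constant_order r = (\<lambda>t s. r)"

fun next_state ::
    "nat \<Rightarrow> ((nat \<Rightarrow> real) \<times> real \<Rightarrow> real) \<Rightarrow> real \<Rightarrow> (nat \<Rightarrow> real) \<times> real \<Rightarrow> (nat \<Rightarrow> real) \<times> real"
where
  "next_state L q c (x, I) =
     ((\<lambda>i\<in>{1..L}. if i < L then x (i + 1) else q (x, I)), max 0 (I + x 1 - c))"

text \<open>\<open>state d L f t\<close> is the state at the start of period \<open>t\<close>, for \<open>t \<ge> 1\<close>; period 1 starts empty,
  and the value at \<open>t = 0\<close> is never used.\<close>

primrec state ::
    "(nat \<Rightarrow> 'a \<Rightarrow> real) \<Rightarrow> nat \<Rightarrow> policy \<Rightarrow> nat \<Rightarrow> 'a \<Rightarrow> (nat \<Rightarrow> real) \<times> real"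
where
  "state d L f 0 \<omega> = ((\<lambda>i\<in>{1..L}. 0), 0)"
| "state d L f (Suc t) \<omega> =
     (if t = 0 then ((\<lambda>i\<in>{1..L}. 0), 0) else next_state L (f t) (d t \<omega>) (state d L f t \<omega>))"

definition newsvendor_cost :: "real \<Rightarrow> real \<Rightarrow> real \<Rightarrow> real" where
  "newsvendor_cost h p y = h * max y 0 + p * max (- y) 0"

definition period_cost ::
    "(nat \<Rightarrow> 'a \<Rightarrow> real) \<Rightarrow> real \<Rightarrow> real \<Rightarrow> nat \<Rightarrow> policy \<Rightarrow> nat \<Rightarrow> 'a \<Rightarrow> real"
where
  "period_cost d h p L f t \<omega> =
     (case state d L f t \<omega> of (x, I) \<Rightarrow> newsvendor_cost h p (I + x 1 - d t \<omega>))"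

text \<open>Expected costs are nonnegative Lebesgue integrals, because an admissible policy may have
  infinite expected cost in some period, where the Bochner integral would be \<open>0\<close>.\<close>

definition average_cost ::
    "'a measure \<Rightarrow> (nat \<Rightarrow> 'a \<Rightarrow> real) \<Rightarrow> real \<Rightarrow> real \<Rightarrow> nat \<Rightarrow> policy \<Rightarrow> ennreal"
where
  "average_cost M d h p L f =
     limsup (\<lambda>T. (\<Sum>t=1..T. \<integral>\<^sup>+\<omega>. ennreal (period_cost d h p L f t \<omega>) \<partial>M) / of_nat T)"

definition OPT :: "'a measure \<Rightarrow> (nat \<Rightarrow> 'a \<Rightarrow> real) \<Rightarrow> real \<Rightarrow> real \<Rightarrow> nat \<Rightarrow> ennreal" where
  "OPT M d h p L = (INF f\<in>admissible L. average_cost M d h p L f)"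

text \<open>The cost of the constant-order policies, set to \<open>\<infinity>\<close> at the mean demand \<open>m\<close>. It does not
  depend on the lead time \<open>L\<close>, but the definition, being that of the model, mentions it.\<close>

definition constant_order_cost ::
    "'a measure \<Rightarrow> (nat \<Rightarrow> 'a \<Rightarrow> real) \<Rightarrow> real \<Rightarrow> real \<Rightarrow> nat \<Rightarrow> real \<Rightarrow> real \<Rightarrow> ennreal"
where
  "constant_order_cost M d h p L m r =
     (if r < m then average_cost M d h p L (constant_order r) else \<infinity>)"

definition r_inf ::
    "'a measure \<Rightarrow> (nat \<Rightarrow> 'a \<Rightarrow> real) \<Rightarrow> real \<Rightarrow> real \<Rightarrow> nat \<Rightarrow> real \<Rightarrow> real"
where
  "r_inf M d h p L m =
     Inf {r \<in> {0..m}. \<forall>s\<in>{0..m}.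
            constant_order_cost M d h p L m r \<le> constant_order_cost M d h p L m s}"

definition phi :: "'a measure \<Rightarrow> ('a \<Rightarrow> real) \<Rightarrow> real \<Rightarrow> real \<Rightarrow> real" where
  "phi M D r \<theta> = exp (\<theta> * r) * (\<integral>\<omega>. exp (- \<theta> * D \<omega>) \<partial>M)"

definition gamma_rate :: "'a measure \<Rightarrow> ('a \<Rightarrow> real) \<Rightarrow> real \<Rightarrow> real" where
  "gamma_rate M D r = (INF \<theta>\<in>{0..}. phi M D r \<theta>)"

definition phi_minimizers :: "'a measure \<Rightarrow> ('a \<Rightarrow> real) \<Rightarrow> real \<Rightarrow> real set" where
  "phi_minimizers M D r = {\<theta> \<in> {0..}. \<forall>\<eta>\<in>{0..}. phi M D r \<theta> \<le> phi M D r \<eta>}"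

definition vartheta_rate :: "'a measure \<Rightarrow> ('a \<Rightarrow> real) \<Rightarrow> real \<Rightarrow> ennreal" where
  "vartheta_rate M D r =
     (if phi_minimizers M D r = {} then \<infinity> else (SUP \<theta>\<in>phi_minimizers M D r. ennreal \<theta>))"

definition newsvendor_opt :: "'a measure \<Rightarrow> ('a \<Rightarrow> real) \<Rightarrow> real \<Rightarrow> real \<Rightarrow> real" where
  "newsvendor_opt M D h p = (INF x. \<integral>\<omega>. newsvendor_cost h p (x - D \<omega>) \<partial>M)"

end

theory Submission
  imports Defs
begin

text \<open>
  Let \<open>r\<close> be the optimal constant order, \<open>S k\<close> the sum of \<open>k\<close> demands and \<open>J\<close> the index at which
  the walk \<open>j r - S j\<close>, \<open>j \<le> L\<close>, is maximal. Under any policy the inventory is at least the sum of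
  the last \<open>J\<close> differences between delivery and demand. The deliveries in question were ordered
  before these demands occurred, so they are independent of \<open>J\<close>, and the expected cost is bounded
  below by an expression that is linear in the expected deliveries, with slope governed by \<open>E J\<close>.
  The cost of the constant order \<open>r\<close> is given by the maximum of the infinite walk. By Spitzer's
  identity, \<open>E max = \<Sum>k\<le>L. E (k r - S k)\<^sup>+ / k\<close> and \<open>E J = \<Sum>k\<le>L. P (S k \<le> k r)\<close>, so truncation
  at \<open>L\<close> loses only tails that Chernoff's bound controls by powers of \<open>\<gamma>\<close>. Optimality of \<open>r\<close> says
  that \<open>p / h\<close> lies between \<open>\<Sum>k. P (S k < k r)\<close> and \<open>\<Sum>k. P (S k \<le> k r)\<close>; mixing the first and the
  last maximizing index makes \<open>h E J\<close> equal to \<open>p\<close> up to such a tail.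
\<close>

section \<open>Maxima of walks\<close>

text \<open>The lower bound must hold whatever the deliveries are. With \<open>Q = E J\<close>, a
  unit of expected delivery raises the holding term by \<open>h * Q\<close> and lowers the
  lost-sales term by \<open>p\<close>. A shortfall against mean demand is therefore harmless if
  \<open>h * Q \<le> p\<close>; an excess ends up as stock and saves no lost sales. If
  \<open>h * Q\<close> is also close to \<open>p\<close>, the bound nearly equals the cost of
  \<open>r\<close>. Optimality of \<open>r\<close> speaks about the same \<open>Q\<close>: the
  factor \<open>k\<close> in the derivative of \<open>(k r - S k)\<^sup>+\<close> cancels the
  \<open>1 / k\<close> of Spitzer's identity, so the hitting probabilities that sum to
  \<open>E J\<close> are also the one-sided slopes of the expected maximum. Atoms of the demand make
  these slopes differ, hence the two tie rules. Two errors remain: the slope error, at most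
  \<open>h * \<gamma> ^ (L + 1) / (1 - \<gamma>)\<close> per unit of \<open>mean - r\<close>, and
  the truncated maximum, where \<open>max 0 x \<le> exp (\<theta> * x) / (e * \<theta>)\<close>
  produces \<open>e * \<theta>\<close> and \<open>1 / k \<le> 1 / (L + 1)\<close> produces
  \<open>L + 1\<close>. The newsvendor bound \<open>g \<le> OPT\<close> turns the additive gap into
  a ratio.\<close>

primrec walk_max :: "nat \<Rightarrow> (nat \<Rightarrow> real) \<Rightarrow> real" where
  "walk_max 0 X = 0"
| "walk_max (Suc n) X = max 0 (X 0 + walk_max n (\<lambda>i. X (Suc i)))"

text \<open>A single flag for strict and weak positivity, so that each argument about the maximizing
  index covers both tie rules at once.\<close>

definition positive :: "bool \<Rightarrow> real \<Rightarrow> bool" where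
  "positive b x \<longleftrightarrow> 0 < x \<or> b \<and> x = 0"

text \<open>The time at which the walk with increments \<open>X\<close> attains its maximum: the last one for
  \<open>b = True\<close>, the first one for \<open>b = False\<close>.\<close>

primrec walk_argmax :: "bool \<Rightarrow> nat \<Rightarrow> (nat \<Rightarrow> real) \<Rightarrow> nat" where
  "walk_argmax b 0 X = 0"
| "walk_argmax b (Suc n) X =
     (if positive b (X 0 + walk_max n (\<lambda>i. X (Suc i)))
      then Suc (walk_argmax b n (\<lambda>i. X (Suc i))) else 0)"

lemma walk_max_nonneg: "0 \<le> walk_max n X"
  by (cases n) auto

lemma walk_max_cong: "(\<And>i. i < n \<Longrightarrow> X i = Y i) \<Longrightarrow> walk_max n X = walk_max n Y"
proof (induction n arbitrary: X Y)
  case (Suc n)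
  have "walk_max n (\<lambda>i. X (Suc i)) = walk_max n (\<lambda>i. Y (Suc i))"
    by (rule Suc.IH) (simp add: Suc.prems)
  then show ?case
    using Suc.prems[of 0] by simp
qed simp

lemma walk_argmax_cong:
  "(\<And>i. i < n \<Longrightarrow> X i = Y i) \<Longrightarrow> walk_argmax b n X = walk_argmax b n Y"
proof (induction n arbitrary: X Y)
  case (Suc n)
  have "walk_argmax b n (\<lambda>i. X (Suc i)) = walk_argmax b n (\<lambda>i. Y (Suc i))"
    by (rule Suc.IH) (simp add: Suc.prems)
  moreover have "walk_max n (\<lambda>i. X (Suc i)) = walk_max n (\<lambda>i. Y (Suc i))"
    by (rule walk_max_cong) (simp add: Suc.prems)
  ultimately show ?case
    using Suc.prems[of 0] by simp
qed simp

lemma walk_argmax_le: "walk_argmax b n X \<le> n"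
  by (induction n arbitrary: X) auto

text \<open>Either tie rule picks an index at which the maximum is attained. This lets the inventory
  bound be used with both.\<close>

lemma sum_walk_argmax: "(\<Sum>i<walk_argmax b n X. X i) = walk_max n X"
proof (induction n arbitrary: X)
  case (Suc n)
  have "(\<Sum>i<Suc (walk_argmax b n (\<lambda>i. X (Suc i))). X i) = X 0 + walk_max n (\<lambda>i. X (Suc i))"
    by (subst sum.lessThan_Suc_shift) (simp add: Suc.IH)
  then show ?case
    by (auto simp: positive_def max_def)
qed simp

text \<open>The definition peels off the first increment, like the inventory recursion read
  backwards in time; here the last one is peeled off. Spitzer's argument needs both ends.\<close>

lemma walk_max_Suc: "walk_max (Suc n) X = max (walk_max n X) (\<Sum>i<Suc n. X i)"
proof (induction n arbitrary: X)
  case (Suc n)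
  let ?X = "\<lambda>i. X (Suc i)"
  have "walk_max (Suc (Suc n)) X = max 0 (X 0 + max (walk_max n ?X) (\<Sum>i<Suc n. ?X i))"
    by (simp only: walk_max.simps(2)[of "Suc n"] Suc.IH)
  also have "\<dots> = max (max 0 (X 0 + walk_max n ?X)) (X 0 + (\<Sum>i<Suc n. ?X i))"
    by (simp add: max_def del: sum.lessThan_Suc)
  also have "\<dots> = max (walk_max (Suc n) X) (\<Sum>i<Suc (Suc n). X i)"
    by (simp only: walk_max.simps(2)[of n] sum.lessThan_Suc_shift[of X "Suc n"])
  finally show ?case .
qed (auto simp: max_def)

lemma walk_argmax_Suc:
  "walk_argmax b (Suc n) X =
     (if positive b ((\<Sum>i<Suc n. X i) - walk_max n X) then Suc n else walk_argmax b n X)"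
proof (induction n arbitrary: X)
  case (Suc n)
  let ?X = "\<lambda>i. X (Suc i)"
  define x s m j where "x = X 0" and "s = (\<Sum>i<Suc n. ?X i)" and "m = walk_max n ?X"
    and "j = walk_argmax b n ?X"
  have S: "(\<Sum>i<Suc (Suc n). X i) = x + s"
    unfolding x_def s_def by (rule sum.lessThan_Suc_shift)
  have W: "walk_max (Suc n) X = max 0 (x + m)"
    unfolding x_def m_def by (rule walk_max.simps)
  have W': "walk_max (Suc n) ?X = max m s"
    unfolding m_def s_def by (rule walk_max_Suc)
  have J: "walk_argmax b (Suc n) X = (if positive b (x + m) then Suc j else 0)"
    unfolding x_def m_def j_def by (rule walk_argmax.simps)
  have J': "walk_argmax b (Suc n) ?X = (if positive b (s - m) then Suc n else j)"
    unfolding s_def m_def j_def by (rule Suc.IH)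
  have "(if positive b (x + max m s) then Suc (if positive b (s - m) then Suc n else j) else 0)
    = (if positive b (x + s - max 0 (x + m)) then Suc (Suc n)
       else if positive b (x + m) then Suc j else 0)"
    by (cases b) (auto simp: max_def positive_def)
  then show ?case
    by (simp only: S W W' J J' walk_argmax.simps(2)[of b "Suc n" X] x_def[symmetric])
qed (simp add: positive_def)

lemma walk_max_Suc_nonpos:
  assumes "\<not> positive b (\<Sum>i<Suc n. X i)"
  shows "walk_max (Suc n) X = walk_max n X"
  using assms walk_max_nonneg[of n X] unfolding walk_max_Suc positive_def by auto

lemma walk_argmax_Suc_nonpos:
  assumes "\<not> positive b (\<Sum>i<Suc n. X i)"
  shows "walk_argmax b (Suc n) X = walk_argmax b n X"
  using assms walk_max_nonneg[of n X] unfolding walk_argmax_Suc positive_def by auto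

text \<open>An endpoint above the start (or level with it, for \<open>b = True\<close>) means that
  the start is dominated by a later time, so the first increment splits off without truncation at
  0.\<close>

lemma walk_max_Suc_pos:
  assumes "positive b (\<Sum>i<Suc n. X i)"
  shows "walk_max (Suc n) X = X 0 + walk_max n (\<lambda>i. X (Suc i))"
proof -
  have "(\<Sum>i<Suc n. X i) = X 0 + (\<Sum>i<n. X (Suc i))"
    by (rule sum.lessThan_Suc_shift)
  moreover have "(\<Sum>i<n. X (Suc i)) \<le> walk_max n (\<lambda>i. X (Suc i))"
    by (cases n) (simp_all add: walk_max_Suc del: sum.lessThan_Suc walk_max.simps(2))
  ultimately show ?thesis
    using assms by (auto simp: positive_def)
qed

lemma walk_argmax_Suc_pos:
  assumes "positive b (\<Sum>i<Suc n. X i)"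
  shows "walk_argmax b (Suc n) X = Suc (walk_argmax b n (\<lambda>i. X (Suc i)))"
proof -
  have "(\<Sum>i<Suc n. X i) = X 0 + (\<Sum>i<n. X (Suc i))"
    by (rule sum.lessThan_Suc_shift)
  moreover have "(\<Sum>i<n. X (Suc i)) \<le> walk_max n (\<lambda>i. X (Suc i))"
    by (cases n) (simp_all add: walk_max_Suc del: sum.lessThan_Suc walk_max.simps(2))
  ultimately have "positive b (X 0 + walk_max n (\<lambda>i. X (Suc i)))"
    using assms by (auto simp: positive_def)
  then show ?thesis
    by simp
qed

lemma walk_max_le_sum_abs: "walk_max n X \<le> (\<Sum>i<n. \<bar>X i\<bar>)"
proof (induction n arbitrary: X)
  case (Suc n)
  have "(\<Sum>i<Suc n. \<bar>X i\<bar>) = \<bar>X 0\<bar> + (\<Sum>i<n. \<bar>X (Suc i)\<bar>)"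
    by (rule sum.lessThan_Suc_shift)
  moreover have "0 \<le> (\<Sum>i<n. \<bar>X (Suc i)\<bar>)"
    by (simp add: sum_nonneg)
  ultimately show ?case
    using Suc.IH[of "\<lambda>i. X (Suc i)"] by auto
qed simp

lemma measurable_positive [measurable]: "Measurable.pred borel (positive b)"
  unfolding positive_def[abs_def] by measurable

lemma borel_measurable_walk_max [measurable (raw)]:
  "(\<And>i. Y i \<in> borel_measurable M) \<Longrightarrow> (\<lambda>\<omega>. walk_max n (\<lambda>i. Y i \<omega>)) \<in> borel_measurable M"
  by (induction n arbitrary: Y) auto

lemma measurable_walk_argmax [measurable (raw)]:
  "(\<And>i. Y i \<in> borel_measurable M) \<Longrightarrow>
    (\<lambda>\<omega>. walk_argmax b n (\<lambda>i. Y i \<omega>)) \<in> measurable M (count_space UNIV)"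
proof (induction n arbitrary: Y)
  case (Suc n)
  note [measurable] = Suc.prems Suc.IH[of "\<lambda>i. Y (Suc i)", OF Suc.prems]
  have [measurable]: "(\<lambda>\<omega>. walk_max n (\<lambda>i. Y (Suc i) \<omega>)) \<in> borel_measurable M"
    by (rule borel_measurable_walk_max) (rule Suc.prems)
  show ?case
    by simp
qed simp

section \<open>Spitzer's identity\<close>

locale iid_demand = prob_space M for M :: "'a measure" +
  fixes D :: "'a \<Rightarrow> real" and d :: "nat \<Rightarrow> 'a \<Rightarrow> real"
  assumes D_measurable [measurable]: "D \<in> borel_measurable M"
    and D_nonneg: "AE \<omega> in M. 0 \<le> D \<omega>"
    and D_integrable: "integrable M D"
    and d_indep: "indep_vars (\<lambda>_. borel) d {1..}"
    and d_distr: "\<And>t. 1 \<le> t \<Longrightarrow> distr M borel (d t) = distr M borel D"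
begin

definition mean :: real where "mean = expectation D"

lemma d_measurable: "1 \<le> t \<Longrightarrow> d t \<in> borel_measurable M"
  using d_indep by (auto simp: indep_vars_def)

lemma d_measurable_Suc [measurable]: "d (Suc t) \<in> borel_measurable M"
  by (rule d_measurable) simp

lemma integral_d:
  assumes "1 \<le> t" and [measurable]: "f \<in> borel_measurable borel"
  shows "expectation (\<lambda>\<omega>. f (d t \<omega>) :: real) = expectation (\<lambda>\<omega>. f (D \<omega>))"
proof -
  note [measurable] = d_measurable[OF assms(1)]
  have "expectation (\<lambda>\<omega>. f (d t \<omega>)) = (\<integral>x. f x \<partial>distr M borel (d t))"
    by (subst integral_distr) auto
  also have "\<dots> = expectation (\<lambda>\<omega>. f (D \<omega>))"
    unfolding d_distr[OF assms(1)] by (subst integral_distr) auto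
  finally show ?thesis .
qed

lemma integrable_d_iff:
  assumes "1 \<le> t" and [measurable]: "f \<in> borel_measurable borel"
  shows "integrable M (\<lambda>\<omega>. f (d t \<omega>) :: real) \<longleftrightarrow> integrable M (\<lambda>\<omega>. f (D \<omega>))"
proof -
  note [measurable] = d_measurable[OF assms(1)]
  have "integrable M (\<lambda>\<omega>. f (d t \<omega>)) \<longleftrightarrow> integrable (distr M borel (d t)) f"
    by (subst integrable_distr_eq) auto
  also have "\<dots> \<longleftrightarrow> integrable M (\<lambda>\<omega>. f (D \<omega>))"
    unfolding d_distr[OF assms(1)] by (subst integrable_distr_eq) auto
  finally show ?thesis .
qed

lemma integrable_d: "1 \<le> t \<Longrightarrow> integrable M (d t)"
  using integrable_d_iff[of t "\<lambda>x. x"] D_integrable by simp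

lemma integrable_d_Suc [simp]: "integrable M (d (Suc t))"
  by (rule integrable_d) simp

lemma expectation_d: "1 \<le> t \<Longrightarrow> expectation (d t) = mean"
  using integral_d[of t "\<lambda>x. x"] by (simp add: mean_def)

lemma AE_d_nonneg: "1 \<le> t \<Longrightarrow> AE \<omega> in M. 0 \<le> d t \<omega>"
proof -
  assume t: "1 \<le> t"
  note [measurable] = d_measurable[OF t]
  have "AE x in distr M borel D. 0 \<le> x"
    using D_nonneg by (subst AE_distr_iff) auto
  then have "AE x in distr M borel (d t). 0 \<le> x"
    by (simp only: d_distr[OF t])
  then show ?thesis
    by (subst (asm) AE_distr_iff) auto
qed

section \<open>Symmetries of an i.i.d. sequence\<close>

lemma indep_vars_reindex:
  assumes "inj \<sigma>" "range \<sigma> \<subseteq> {1..}"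
  shows "indep_vars (\<lambda>_. borel) (\<lambda>i. d (\<sigma> i)) UNIV"
proof -
  \<comment> \<open>Reindexing is grouping into singleton blocks \<open>{\<sigma> i}\<close>, which
    are disjoint because \<open>\<sigma>\<close> is injective.\<close>
  have "indep_vars (\<lambda>i. PiM {\<sigma> i} (\<lambda>_. borel)) (\<lambda>i \<omega>. restrict (\<lambda>j. d j \<omega>) {\<sigma> i}) UNIV"
    using assms
    by (intro indep_vars_restrict[OF d_indep]) (auto simp: disjoint_family_on_def dest: injD)
  then have "indep_vars (\<lambda>_. borel)
      (\<lambda>i. (\<lambda>f. f (\<sigma> i)) \<circ> (\<lambda>\<omega>. restrict (\<lambda>j. d j \<omega>) {\<sigma> i})) UNIV"
    by (rule indep_vars_compose) auto
  then show ?thesis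
    by (simp add: comp_def)
qed

lemma distr_reindex:
  assumes "inj \<sigma>" "range \<sigma> \<subseteq> {1..}"
  shows "distr M (PiM UNIV (\<lambda>_. borel)) (\<lambda>\<omega> i. d (\<sigma> i) \<omega>) = PiM UNIV (\<lambda>_. distr M borel D)"
proof -
  have ge: "1 \<le> \<sigma> i" for i
    using assms(2) by auto
  have "distr M (\<Pi>\<^sub>M i\<in>UNIV. borel) (\<lambda>\<omega>. \<lambda>i\<in>UNIV. d (\<sigma> i) \<omega>)
      = (\<Pi>\<^sub>M i\<in>UNIV. distr M borel (d (\<sigma> i)))"
    using indep_vars_reindex[OF assms] d_measurable[OF ge]
    by (subst (asm) indep_vars_iff_distr_eq_PiM') auto
  then show ?thesis
    by (simp only: d_distr[OF ge] restrict_UNIV)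
qed

text \<open>Both sequences have the same product law. It is applied to permutations in Spitzer's
  identity and to time reversal in the inventory bounds.\<close>

lemma expectation_reindex:
  assumes "inj \<sigma>" "range \<sigma> \<subseteq> {1..}"
    and [measurable]: "H \<in> borel_measurable (PiM UNIV (\<lambda>_. borel))"
  shows "expectation (\<lambda>\<omega>. H (\<lambda>i. d (\<sigma> i) \<omega>) :: real) = expectation (\<lambda>\<omega>. H (\<lambda>i. d (Suc i) \<omega>))"
proof -
  have ge: "1 \<le> \<sigma> i" for i
    using assms(2) by auto
  note [measurable] = d_measurable[OF ge]
  have [measurable]: "(\<lambda>\<omega> i. d (\<sigma> i) \<omega>) \<in> measurable M (PiM UNIV (\<lambda>_. borel))"
    by (rule measurable_PiM_single') auto
  have [measurable]: "(\<lambda>\<omega> i. d (Suc i) \<omega>) \<in> measurable M (PiM UNIV (\<lambda>_. borel))"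
    by (rule measurable_PiM_single') auto
  have "expectation (\<lambda>\<omega>. H (\<lambda>i. d (\<sigma> i) \<omega>))
      = (\<integral>z. H z \<partial>distr M (PiM UNIV (\<lambda>_. borel)) (\<lambda>\<omega> i. d (\<sigma> i) \<omega>))"
    by (subst integral_distr) auto
  also have "\<dots> = (\<integral>z. H z \<partial>distr M (PiM UNIV (\<lambda>_. borel)) (\<lambda>\<omega> i. d (Suc i) \<omega>))"
    using assms(1,2) by (subst (1 2) distr_reindex) auto
  also have "\<dots> = expectation (\<lambda>\<omega>. H (\<lambda>i. d (Suc i) \<omega>))"
    by (subst integral_distr) auto
  finally show ?thesis .
qed

lemma expectation_permute:
  assumes "inj \<sigma>" and "H \<in> borel_measurable (PiM UNIV (\<lambda>_. borel))"
  shows "expectation (\<lambda>\<omega>. H (\<lambda>i. d (Suc (\<sigma> i)) \<omega>) :: real) = expectation (\<lambda>\<omega>. H (\<lambda>i. d (Suc i) \<omega>))"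
  by (rule expectation_reindex[where \<sigma> = "\<lambda>i. Suc (\<sigma> i)"])
     (use assms in \<open>auto simp: inj_def\<close>)

definition demand_sum :: "nat \<Rightarrow> 'a \<Rightarrow> real" where
  "demand_sum n \<omega> = (\<Sum>i<n. d (Suc i) \<omega>)"

lemma demand_sum_measurable [measurable]: "demand_sum n \<in> borel_measurable M"
  unfolding demand_sum_def[abs_def] by measurable

lemma integrable_demand_sum [simp]: "integrable M (demand_sum n)"
  unfolding demand_sum_def[abs_def] by simp

lemma sum_increments: "(\<Sum>i<n. r - d (Suc i) \<omega>) = n * r - demand_sum n \<omega>"
  by (simp add: demand_sum_def sum_subtractf)

text \<open>Both the maximum of a walk and its location satisfy the hypotheses. If the walk ends above
  its start, moving the first increment to the end changes neither the law nor the final value.\<close>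

lemma expectation_cyclic:
  fixes H :: "nat \<Rightarrow> (nat \<Rightarrow> real) \<Rightarrow> real" and c :: "real \<Rightarrow> real"
  assumes cong: "\<And>n X Y. (\<And>i. i < n \<Longrightarrow> X i = Y i) \<Longrightarrow> H n X = H n Y"
    and pos: "\<And>X. positive b (\<Sum>i<Suc n. X i) \<Longrightarrow> H (Suc n) X = c (X 0) + H n (\<lambda>i. X (Suc i))"
    and nonpos: "\<And>X. \<not> positive b (\<Sum>i<Suc n. X i) \<Longrightarrow> H (Suc n) X = H n X"
    and meas: "\<And>N Y. (\<And>i. Y i \<in> borel_measurable N) \<Longrightarrow>
      (\<lambda>x :: nat \<Rightarrow> real. H n (\<lambda>i. Y i x)) \<in> borel_measurable N"
    and int: "\<And>Y. (\<And>i. integrable M (Y i)) \<Longrightarrow> integrable M (\<lambda>\<omega>. H n (\<lambda>i. Y i \<omega>))"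
    and cint: "integrable M (\<lambda>\<omega>. c (r - d (Suc 0) \<omega>))"
  shows "expectation (\<lambda>\<omega>. H (Suc n) (\<lambda>i. r - d (Suc i) \<omega>)) =
    expectation (\<lambda>\<omega>. H n (\<lambda>i. r - d (Suc i) \<omega>)) +
    expectation (\<lambda>\<omega>. c (r - d (Suc 0) \<omega>) * of_bool (positive b (\<Sum>i<Suc n. r - d (Suc i) \<omega>)))"
proof -
  let ?X = "\<lambda>\<omega> i. r - d (Suc i) \<omega>"
  let ?P = "\<lambda>\<omega>. positive b (\<Sum>i<Suc n. ?X \<omega> i)"
  have P [measurable]: "Measurable.pred M ?P"
    by measurable
  have i1: "integrable M (\<lambda>\<omega>. H n (?X \<omega>))" and i2: "integrable M (\<lambda>\<omega>. H n (\<lambda>i. ?X \<omega> (Suc i)))"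
    by (rule int, simp)+
  have restr: "integrable M (\<lambda>\<omega>. f \<omega> * of_bool (?P \<omega>))"
    if "integrable M f" for f :: "'a \<Rightarrow> real"
    using that by (rule Bochner_Integration.integrable_bound) (use that in auto)
  have restr': "integrable M (\<lambda>\<omega>. f \<omega> * of_bool (\<not> ?P \<omega>))"
    if "integrable M f" for f :: "'a \<Rightarrow> real"
    using that by (rule Bochner_Integration.integrable_bound) (use that in auto)
  \<comment> \<open>The cyclic shift of the indices up to \<open>n\<close>; beyond \<open>n\<close>
    it is the identity, so that it is injective on all naturals.\<close>
  define \<sigma> where "\<sigma> = (\<lambda>i. if i < n then Suc i else if i = n then 0 else i)"
  have \<sigma>: "inj \<sigma>"
    by (auto simp: inj_def \<sigma>_def split: if_splits)
  define K where "K = (\<lambda>z. H n (\<lambda>i. r - z i) * of_bool (positive b (\<Sum>i<Suc n. r - z i)))"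
  have [measurable]: "(\<lambda>z :: nat \<Rightarrow> real. H n (\<lambda>i. r - z i)) \<in> borel_measurable (PiM UNIV (\<lambda>_. borel))"
    by (rule meas) measurable
  have K: "K \<in> borel_measurable (PiM UNIV (\<lambda>_. borel))"
    unfolding K_def by measurable
  have sum_\<sigma>: "(\<Sum>i<Suc n. r - d (Suc (\<sigma> i)) \<omega>) = (\<Sum>i<Suc n. ?X \<omega> i)" for \<omega>
  proof -
    have "(\<Sum>i<Suc n. r - d (Suc (\<sigma> i)) \<omega>) = (\<Sum>i<n. ?X \<omega> (Suc i)) + ?X \<omega> 0"
      by (simp add: \<sigma>_def)
    also have "\<dots> = (\<Sum>i<Suc n. ?X \<omega> i)"
      by (subst sum.lessThan_Suc_shift) simp
    finally show ?thesis .
  qed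
  have "K (\<lambda>i. d (Suc (\<sigma> i)) \<omega>) = H n (\<lambda>i. ?X \<omega> (Suc i)) * of_bool (?P \<omega>)" for \<omega>
    unfolding K_def sum_\<sigma>
    by (subst cong[of n "\<lambda>i. r - d (Suc (\<sigma> i)) \<omega>" "\<lambda>i. ?X \<omega> (Suc i)"]) (simp_all add: \<sigma>_def)
  \<comment> \<open>The shift turns the first \<open>n\<close> increments into increments 1 to
    \<open>n\<close> and fixes the total, hence the event: on it, dropping the first or the last
    increment gives the same expectation.\<close>
  then have swap: "expectation (\<lambda>\<omega>. H n (\<lambda>i. ?X \<omega> (Suc i)) * of_bool (?P \<omega>))
      = expectation (\<lambda>\<omega>. H n (?X \<omega>) * of_bool (?P \<omega>))"
    using expectation_permute[OF \<sigma> K] by (simp add: K_def)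
  have "expectation (\<lambda>\<omega>. H (Suc n) (?X \<omega>)) = expectation (\<lambda>\<omega>.
      c (?X \<omega> 0) * of_bool (?P \<omega>) + (H n (\<lambda>i. ?X \<omega> (Suc i)) * of_bool (?P \<omega>) +
      H n (?X \<omega>) * of_bool (\<not> ?P \<omega>)))"
    by (intro Bochner_Integration.integral_cong refl)
       (auto simp: pos nonpos simp del: sum.lessThan_Suc)
  also have "\<dots> = expectation (\<lambda>\<omega>. c (?X \<omega> 0) * of_bool (?P \<omega>)) +
      (expectation (\<lambda>\<omega>. H n (\<lambda>i. ?X \<omega> (Suc i)) * of_bool (?P \<omega>)) +
      expectation (\<lambda>\<omega>. H n (?X \<omega>) * of_bool (\<not> ?P \<omega>)))"
    using restr[OF cint] restr[OF i2] restr'[OF i1] by simp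
  also have "\<dots> = expectation (\<lambda>\<omega>. c (?X \<omega> 0) * of_bool (?P \<omega>)) +
      expectation (\<lambda>\<omega>. H n (?X \<omega>) * of_bool (?P \<omega>) + H n (?X \<omega>) * of_bool (\<not> ?P \<omega>))"
    unfolding swap using restr[OF i1] restr'[OF i1] by simp
  also have "(\<lambda>\<omega>. H n (?X \<omega>) * of_bool (?P \<omega>) + H n (?X \<omega>) * of_bool (\<not> ?P \<omega>)) = (\<lambda>\<omega>. H n (?X \<omega>))"
    by auto
  finally show ?thesis
    by simp
qed

lemma integrable_walk_max:
  assumes "\<And>i. integrable M (Y i)"
  shows "integrable M (\<lambda>\<omega>. walk_max n (\<lambda>i. Y i \<omega>))"
proof (rule Bochner_Integration.integrable_bound)
  show "integrable M (\<lambda>\<omega>. \<Sum>i<n. \<bar>Y i \<omega>\<bar>)"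
    using assms by simp
  show "(\<lambda>\<omega>. walk_max n (\<lambda>i. Y i \<omega>)) \<in> borel_measurable M"
    using assms by (intro borel_measurable_walk_max) auto
  show "AE \<omega> in M. norm (walk_max n (\<lambda>i. Y i \<omega>)) \<le> norm (\<Sum>i<n. \<bar>Y i \<omega>\<bar>)"
    using walk_max_le_sum_abs[of n] walk_max_nonneg[of n]
    by (auto intro!: AE_I2 order_trans[OF _ abs_ge_self])
qed

lemma integrable_walk_argmax:
  assumes "\<And>i. Y i \<in> borel_measurable M"
  shows "integrable M (\<lambda>\<omega>. real (walk_argmax b n (\<lambda>i. Y i \<omega>)))"
proof (rule integrable_const_bound[where B = "real n"])
  have [measurable]: "(\<lambda>\<omega>. walk_argmax b n (\<lambda>i. Y i \<omega>)) \<in> measurable M (count_space UNIV)"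
    using assms by (rule measurable_walk_argmax)
  show "(\<lambda>\<omega>. real (walk_argmax b n (\<lambda>i. Y i \<omega>))) \<in> borel_measurable M"
    by measurable
qed (use walk_argmax_le[of b n] in auto)

definition \<mu> :: "nat \<Rightarrow> real \<Rightarrow> real" where
  "\<mu> n r = expectation (\<lambda>\<omega>. walk_max n (\<lambda>i. r - d (Suc i) \<omega>))"

definition surplus :: "nat \<Rightarrow> real \<Rightarrow> real" where
  "surplus k r = expectation (\<lambda>\<omega>. max 0 (k * r - demand_sum k \<omega>))"

lemma integrable_surplus: "integrable M (\<lambda>\<omega>. max 0 (real k * r - demand_sum k \<omega>))"
  by (rule integrable_max) simp_all

text \<open>The event depends only on the total and is thus symmetric in the increments. All
  \<open>Suc n\<close> of them contribute equally, and together they contribute the positive part of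
  the endpoint.\<close>

lemma expectation_first_increment:
  "expectation (\<lambda>\<omega>. (r - d (Suc 0) \<omega>) * of_bool (positive b (\<Sum>i<Suc n. r - d (Suc i) \<omega>)))
    = surplus (Suc n) r / Suc n"
proof -
  let ?P = "\<lambda>\<omega>. positive b (\<Sum>i<Suc n. r - d (Suc i) \<omega>)"
  let ?e = "\<lambda>k. expectation (\<lambda>\<omega>. (r - d (Suc k) \<omega>) * of_bool (?P \<omega>))"
  have P [measurable]: "Measurable.pred M ?P"
    by measurable
  have restr: "integrable M (\<lambda>\<omega>. (r - d (Suc k) \<omega>) * of_bool (?P \<omega>))" for k
  proof (rule Bochner_Integration.integrable_bound)
    show "integrable M (\<lambda>\<omega>. r - d (Suc k) \<omega>)"
      by simp
  qed auto
  have sym: "?e k = ?e 0" if k: "k < Suc n" for k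
  proof -
    \<comment> \<open>Exchanging increments 0 and \<open>k\<close> leaves the total
      unchanged.\<close>
    define \<sigma> where "\<sigma> = Transposition.transpose 0 k"
    define K where "K = (\<lambda>z. (r - z 0) * of_bool (positive b (\<Sum>i<Suc n. r - z i)) :: real)"
    have \<sigma>: "bij \<sigma>"
      unfolding \<sigma>_def by simp
    have K: "K \<in> borel_measurable (PiM UNIV (\<lambda>_. borel))"
      unfolding K_def by measurable
    have bij: "bij_betw \<sigma> {..<Suc n} {..<Suc n}"
      unfolding \<sigma>_def
      by (rule permutes_imp_bij, rule permutes_subset[OF permutes_swap_id[of 0 "{0, k}" k]])
         (use k in auto)
    have sum_\<sigma>: "(\<Sum>i<Suc n. r - d (Suc (\<sigma> i)) \<omega>) = (\<Sum>i<Suc n. r - d (Suc i) \<omega>)" for \<omega>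
      using sum.reindex_bij_betw[OF bij, of "\<lambda>i. r - d (Suc i) \<omega>"] .
    have \<sigma>_0: "\<sigma> 0 = k"
      by (simp add: \<sigma>_def)
    have "?e k = expectation (\<lambda>\<omega>. K (\<lambda>i. d (Suc (\<sigma> i)) \<omega>))"
      unfolding K_def sum_\<sigma> \<sigma>_0 ..
    also have "\<dots> = expectation (\<lambda>\<omega>. K (\<lambda>i. d (Suc i) \<omega>))"
      by (rule expectation_permute[OF bij_is_inj[OF \<sigma>] K])
    also have "\<dots> = ?e 0"
      unfolding K_def ..
    finally show ?thesis .
  qed
  have "real (Suc n) * ?e 0 = (\<Sum>k<Suc n. ?e 0)"
    by (simp only: sum_constant card_lessThan)
  also have "\<dots> = (\<Sum>k<Suc n. ?e k)"
    by (rule sum.cong[OF refl], rule sym[symmetric], simp only: lessThan_iff)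
  also have "\<dots> = expectation (\<lambda>\<omega>. \<Sum>k<Suc n. (r - d (Suc k) \<omega>) * of_bool (?P \<omega>))"
    using restr by (intro Bochner_Integration.integral_sum[symmetric]) auto
  \<comment> \<open>Both tie rules give the same value, since a total of 0 contributes
    nothing.\<close>
  also have "\<dots> = surplus (Suc n) r"
    unfolding surplus_def sum_increments[symmetric] sum_distrib_right[symmetric]
    by (intro Bochner_Integration.integral_cong refl) (auto simp: positive_def max_def)
  finally show ?thesis
    by (simp only: nonzero_eq_divide_eq of_nat_neq_0 mult.commute not_False_eq_True)
qed

lemma \<mu>_0 [simp]: "\<mu> 0 r = 0"
  by (simp add: \<mu>_def)

text \<open>Spitzer's identity for the mean of the maximum: when the walk ends above its start, the
  cyclic argument gains the first increment.\<close>

lemma \<mu>_Suc: "\<mu> (Suc n) r = \<mu> n r + surplus (Suc n) r / Suc n"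
proof -
  have "expectation (\<lambda>\<omega>. walk_max (Suc n) (\<lambda>i. r - d (Suc i) \<omega>)) =
    expectation (\<lambda>\<omega>. walk_max n (\<lambda>i. r - d (Suc i) \<omega>)) +
    expectation (\<lambda>\<omega>. (r - d (Suc 0) \<omega>) * of_bool (positive True (\<Sum>i<Suc n. r - d (Suc i) \<omega>)))"
  proof (rule expectation_cyclic[where H = walk_max and c = "\<lambda>x. x"])
    show "integrable M (\<lambda>\<omega>. r - d (Suc 0) \<omega>)"
      by simp
  qed (fact walk_max_cong walk_max_Suc_pos walk_max_Suc_nonpos integrable_walk_max
       borel_measurable_walk_max | simp)+
  then show ?thesis
    by (simp only: \<mu>_def expectation_first_increment)
qed

lemma \<mu>_eq_sum: "\<mu> n r = (\<Sum>k=1..n. surplus k r / k)"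
  by (induction n) (simp_all add: \<mu>_Suc)

definition hit_prob :: "bool \<Rightarrow> nat \<Rightarrow> real \<Rightarrow> real" where
  "hit_prob b k r = prob {\<omega> \<in> space M. positive b (k * r - demand_sum k \<omega>)}"

text \<open>The same cyclic argument, with gain 1 in place of the first increment: splitting it off
  lowers the maximizing index by one.\<close>

lemma expectation_walk_argmax:
  "expectation (\<lambda>\<omega>. real (walk_argmax b n (\<lambda>i. r - d (Suc i) \<omega>))) = (\<Sum>k=1..n. hit_prob b k r)"
proof (induction n)
  case (Suc n)
  have [measurable]: "Measurable.pred M (\<lambda>\<omega>. positive b (\<Sum>i<Suc n. r - d (Suc i) \<omega>))"
    by measurable
  have "expectation (\<lambda>\<omega>. real (walk_argmax b (Suc n) (\<lambda>i. r - d (Suc i) \<omega>))) =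
    expectation (\<lambda>\<omega>. real (walk_argmax b n (\<lambda>i. r - d (Suc i) \<omega>))) +
    expectation (\<lambda>\<omega>. (1::real) * of_bool (positive b (\<Sum>i<Suc n. r - d (Suc i) \<omega>)))"
  proof (rule expectation_cyclic[where H = "\<lambda>n X. real (walk_argmax b n X)" and c = "\<lambda>_. 1"])
    show "(\<lambda>x. real (walk_argmax b n (\<lambda>i. Y i x))) \<in> borel_measurable N"
      if "\<And>i. Y i \<in> borel_measurable N" for Y and N :: "(nat \<Rightarrow> real) measure"
      using measurable_walk_argmax[of Y N b n, OF that] by measurable
    show "integrable M (\<lambda>\<omega>. real (walk_argmax b n (\<lambda>i. Y i \<omega>)))" if "\<And>i. integrable M (Y i)" for Y
      using that by (intro integrable_walk_argmax) auto
    show "real (walk_argmax b n X) = real (walk_argmax b n Y)" if "\<And>i. i < n \<Longrightarrow> X i = Y i" for n X Y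
      by (simp only: walk_argmax_cong[OF that])
    show "real (walk_argmax b (Suc n) X) = 1 + real (walk_argmax b n (\<lambda>i. X (Suc i)))"
      if "positive b (\<Sum>i<Suc n. X i)" for X
      by (simp only: walk_argmax_Suc_pos[OF that] of_nat_Suc)
    show "real (walk_argmax b (Suc n) X) = real (walk_argmax b n X)"
      if "\<not> positive b (\<Sum>i<Suc n. X i)" for X
      by (simp only: walk_argmax_Suc_nonpos[OF that])
  qed simp_all
  also have "expectation (\<lambda>\<omega>. (1::real) * of_bool (positive b (\<Sum>i<Suc n. r - d (Suc i) \<omega>)))
      = hit_prob b (Suc n) r"
  proof -
    let ?A = "{\<omega> \<in> space M. positive b (Suc n * r - demand_sum (Suc n) \<omega>)}"
    have "expectation (\<lambda>\<omega>. (1::real) * of_bool (positive b (Suc n * r - demand_sum (Suc n) \<omega>)))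
        = expectation (indicator ?A)"
      by (intro Bochner_Integration.integral_cong refl) (auto simp: indicator_def)
    also have "\<dots> = prob ?A"
      by simp
    finally show ?thesis
      unfolding sum_increments hit_prob_def .
  qed
  finally show ?case
    by (simp add: Suc.IH)
qed simp

end

section \<open>Dynamics of the inventory\<close>

abbreviation inventory :: "(nat \<Rightarrow> 'a \<Rightarrow> real) \<Rightarrow> nat \<Rightarrow> policy \<Rightarrow> nat \<Rightarrow> 'a \<Rightarrow> real" where
  "inventory d L f t \<omega> \<equiv> snd (state d L f t \<omega>)"

abbreviation delivery :: "(nat \<Rightarrow> 'a \<Rightarrow> real) \<Rightarrow> nat \<Rightarrow> policy \<Rightarrow> nat \<Rightarrow> 'a \<Rightarrow> real" where
  "delivery d L f t \<omega> \<equiv> fst (state d L f t \<omega>) 1"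

lemma next_state_eq:
  "next_state L q c s =
     ((\<lambda>i\<in>{1..L}. if i < L then fst s (i + 1) else q s), max 0 (snd s + fst s 1 - c))"
  by (cases s) (simp add: fun_eq_iff)

lemma state_1: "state d L f (Suc 0) \<omega> = ((\<lambda>i\<in>{1..L}. 0), 0)"
  by simp

lemma state_Suc:
  "1 \<le> t \<Longrightarrow> state d L f (Suc t) \<omega> = next_state L (f t) (d t \<omega>) (state d L f t \<omega>)"
  by simp

declare state.simps(2) [simp del]

text \<open>Slot \<open>i\<close> at time \<open>t\<close> holds the order placed at time
  \<open>t + i - 1 - L\<close>; the condition says that this time is at least 1, and otherwise the
  slot still carries the empty initial pipeline.\<close>

lemma fst_state:
  assumes "1 \<le> t" "1 \<le> i" "i \<le> L"
  shows "fst (state d L f t \<omega>) i =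
    (if L + 2 \<le> t + i then f (t + i - 1 - L) (state d L f (t + i - 1 - L) \<omega>) else 0)"
  using assms
proof (induction t arbitrary: i rule: dec_induct)
  case base
  then show ?case
    by (simp add: state_1)
next
  case (step t)
  show ?case
  proof (cases "i < L")
    case True
    then show ?thesis
      using step.IH[of "i + 1"] step.prems step.hyps
      by (simp add: state_Suc next_state_eq)
  next
    case False
    then show ?thesis
      using step.prems step.hyps by (simp add: state_Suc next_state_eq)
  qed
qed

lemma delivery_eq:
  assumes "1 \<le> t" "1 \<le> L"
  shows "delivery d L f t \<omega> = (if L < t then f (t - L) (state d L f (t - L) \<omega>) else 0)"
  using fst_state[of t 1 L d f \<omega>] assms by auto

lemma inventory_Suc:
  "1 \<le> t \<Longrightarrow> inventory d L f (Suc t) \<omega> = max 0 (inventory d L f t \<omega> + delivery d L f t \<omega> - d t \<omega>)"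
  by (simp add: state_Suc next_state_eq)

lemma inventory_nonneg: "0 \<le> inventory d L f t \<omega>"
proof (cases t)
  case (Suc n)
  then show ?thesis
    by (cases "n = 0") (simp_all add: state_1 inventory_Suc)
qed simp

text \<open>Leaving out the truncation at 0 in each of the last \<open>j\<close> periods can only
  lower the inventory.\<close>

lemma inventory_ge_sum:
  assumes "j \<le> t"
  shows "inventory d L f (Suc t - j) \<omega> + (\<Sum>i<j. delivery d L f (t - i) \<omega> - d (t - i) \<omega>)
    \<le> inventory d L f (Suc t) \<omega>"
  using assms
proof (induction j)
  case (Suc j)
  then have "Suc t - j = Suc (t - j)" "1 \<le> t - j" "Suc t - Suc j = t - j"
    by auto
  then have "inventory d L f (Suc t - Suc j) \<omega> + (delivery d L f (t - j) \<omega> - d (t - j) \<omega>)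
      \<le> inventory d L f (Suc t - j) \<omega>"
    by (simp add: inventory_Suc max_def)
  then show ?case
    using Suc by simp
qed simp

text \<open>Lost sales are the truncated net inventory minus the untruncated one. The cost becomes
  linear in quantities with tractable expectations, and the inventory differences telescope over
  time.\<close>

lemma period_cost_eq:
  assumes "1 \<le> t"
  shows "period_cost d h p L f t \<omega> = h * inventory d L f (Suc t) \<omega> +
    p * (inventory d L f (Suc t) \<omega> - inventory d L f t \<omega> - delivery d L f t \<omega> + d t \<omega>)"
proof -
  define y where "y = inventory d L f t \<omega> + delivery d L f t \<omega> - d t \<omega>"
  have "max (- y) 0 = max 0 y - y" and "max y 0 = max 0 y"
    by simp_all
  moreover have "inventory d L f (Suc t) \<omega> - inventory d L f t \<omega> - delivery d L f t \<omega> + d t \<omega>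
      = max 0 y - y" and "inventory d L f (Suc t) \<omega> = max 0 y"
    using assms by (simp_all add: inventory_Suc y_def)
  ultimately show ?thesis
    by (simp only: period_cost_def newsvendor_cost_def case_prod_beta y_def[symmetric])
qed

lemma period_cost_ge:
  assumes "1 \<le> t" "0 \<le> p"
  shows "h * inventory d L f (Suc t) \<omega> \<le> period_cost d h p L f t \<omega>"
proof -
  have "0 \<le> p * max (- (inventory d L f t \<omega> + delivery d L f t \<omega> - d t \<omega>)) 0"
    using assms by simp
  then show ?thesis
    using assms by (simp add: period_cost_def newsvendor_cost_def inventory_Suc case_prod_beta max.commute)
qed

lemma period_cost_nonneg: "0 \<le> h \<Longrightarrow> 0 \<le> p \<Longrightarrow> 0 \<le> period_cost d h p L f t \<omega>"
  by (simp add: period_cost_def newsvendor_cost_def case_prod_beta)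

text \<open>Causality: only demands before \<open>t\<close> enter. Two different sample spaces are
  allowed so that a state can be recomputed from a restricted demand vector.\<close>

lemma state_demand_cong:
  assumes "\<And>i. 1 \<le> i \<Longrightarrow> i < t \<Longrightarrow> d i \<omega> = d' i \<omega>'"
  shows "state d L f t \<omega> = state d' L f t \<omega>'"
  using assms
proof (induction t)
  case (Suc t)
  then show ?case
    by (cases "t = 0") (simp_all add: state_1 state_Suc)
qed simp

lemma measurable_fst_state_space:
  assumes "1 \<le> i" "i \<le> L"
  shows "(\<lambda>s. fst s i) \<in> state_space L \<rightarrow>\<^sub>M restrict_space borel {0..}"
proof -
  have "(\<lambda>s. s i) \<in> (\<Pi>\<^sub>M i\<in>{1..L}. restrict_space borel {0..}) \<rightarrow>\<^sub>M restrict_space (borel :: real measure) {0..}"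
    using assms by (intro measurable_component_singleton) auto
  then show ?thesis
    unfolding state_space_def by (rule measurable_compose[OF measurable_fst])
qed

lemma measurable_snd_state_space: "snd \<in> state_space L \<rightarrow>\<^sub>M restrict_space borel {0..}"
  unfolding state_space_def by (rule measurable_snd)

lemma measurable_nonneg_real:
  "f \<in> N \<rightarrow>\<^sub>M restrict_space (borel :: real measure) {0..} \<longleftrightarrow>
    f \<in> borel_measurable N \<and> (\<forall>x\<in>space N. 0 \<le> f x)"
  by (auto simp: measurable_restrict_space2_iff)

text \<open>Stated over an arbitrary space \<open>N\<close>, because it serves both for
  \<open>M\<close> and for the product space of the demand vectors.\<close>

lemma measurable_state:
  assumes f: "f \<in> admissible L" and L: "1 \<le> L"
    and d: "\<And>i. 1 \<le> i \<Longrightarrow> i < t \<Longrightarrow> d i \<in> borel_measurable N" and t: "1 \<le> t"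
  shows "state d L f t \<in> N \<rightarrow>\<^sub>M state_space L"
  using t d
proof (induction t rule: dec_induct)
  case base
  show ?case
    unfolding One_nat_def state_1[abs_def] state_space_def
    by (intro measurable_Pair measurable_restrict measurable_const)
      (auto simp: space_restrict_space)
next
  case (step t)
  then have s: "state d L f t \<in> N \<rightarrow>\<^sub>M state_space L" and dt: "d t \<in> borel_measurable N"
    by auto
  have q: "f t \<in> state_space L \<rightarrow>\<^sub>M restrict_space borel {0..}"
    using f step.hyps by (auto simp: admissible_def)
  have comp: "(\<lambda>\<omega>. snd (state d L f t \<omega>)) \<in> borel_measurable N"
      "(\<lambda>\<omega>. fst (state d L f t \<omega>) 1) \<in> borel_measurable N"
    using measurable_compose[OF s measurable_snd_state_space]
      measurable_compose[OF s measurable_fst_state_space[of 1]] L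
    by (auto simp: measurable_nonneg_real)
  have inv: "(\<lambda>\<omega>. max 0 (snd (state d L f t \<omega>) + fst (state d L f t \<omega>) 1 - d t \<omega>))
      \<in> N \<rightarrow>\<^sub>M restrict_space borel {0..}"
    unfolding measurable_nonneg_real
    by (intro conjI ballI borel_measurable_max borel_measurable_diff borel_measurable_add comp dt) auto
  have pipe: "(\<lambda>\<omega>. if i < L then fst (state d L f t \<omega>) (i + 1) else f t (state d L f t \<omega>))
      \<in> N \<rightarrow>\<^sub>M restrict_space borel {0..}" if "i \<in> {1..L}" for i
    using measurable_compose[OF s q] measurable_compose[OF s measurable_fst_state_space[of "i + 1"]] that
    by (cases "i < L") auto
  have "state d L f (Suc t) = (\<lambda>\<omega>. next_state L (f t) (d t \<omega>) (state d L f t \<omega>))"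
    using step.hyps by (simp add: fun_eq_iff state_Suc)
  then show ?case
    unfolding state_space_def next_state_eq
    by (simp only:) (intro measurable_Pair measurable_restrict pipe inv)
qed

text \<open>Only the holding cost is kept in the last \<open>L\<close> periods, so that each delivery \<open>a t\<close> with
  \<open>t \<le> T\<close> enters all \<open>L\<close> of the bounds \<open>w\<close> in which it can occur. The inventory left at the end of
  period \<open>T\<close> absorbs a total delivery in excess of the expected demand.\<close>

lemma cost_sum_lower_bound:
  fixes a b c q :: "nat \<Rightarrow> real" and h p m r w :: real
  assumes "0 \<le> h" "0 \<le> p"
    and a: "\<And>t. 1 \<le> t \<Longrightarrow> 0 \<le> a t" "\<And>t. 1 \<le> t \<Longrightarrow> t \<le> L \<Longrightarrow> a t = 0"
    and b: "b (Suc 0) = 0" "\<And>t. 1 \<le> t \<Longrightarrow> 0 \<le> b t"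
    and bdiff: "\<And>t. 1 \<le> t \<Longrightarrow> 0 \<le> b (Suc t) - b t - a t + m"
    and c: "\<And>t. 1 \<le> t \<Longrightarrow> c t = h * b (Suc t) + p * (b (Suc t) - b t - a t + m)"
    and w: "\<And>t. L \<le> t \<Longrightarrow> w + (\<Sum>i<L. q i * (a (t - i) - r)) \<le> b (Suc t)"
    and q: "\<And>i. 0 \<le> q i" and le: "h * (\<Sum>i<L. q i) \<le> p" and "1 \<le> L"
  shows "h * real (T + 1) * (w - r * (\<Sum>i<L. q i)) + h * (\<Sum>i<L. q i) * m * T \<le> (\<Sum>t=1..T+L. c t)"
proof -
  define Q where "Q = (\<Sum>i<L. q i)"
  define A where "A T = (\<Sum>t=1..T. a t)" for T
  have A: "p * (\<Sum>t=1..n. b (Suc t) - b t - a t + m) = p * (b (Suc n) - A n + m * n)" for n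
    by (induction n) (simp_all add: A_def b algebra_simps)
  have bA: "A n - m * n \<le> b (Suc n)" for n
  proof -
    have "0 \<le> (\<Sum>t=1..n. b (Suc t) - b t - a t + m)"
      by (rule sum_nonneg) (use bdiff in auto)
    also have "\<dots> = b (Suc n) - A n + m * n"
      by (induction n) (simp_all add: A_def b algebra_simps)
    finally show ?thesis
      by simp
  qed
  have mono: "A n \<le> A n'" if "n \<le> n'" for n n'
    unfolding A_def by (rule sum_mono2) (use that a in auto)
  \<comment> \<open>At lag \<open>i\<close> the bounds for \<open>t\<close> from \<open>L\<close> to
    \<open>T + L\<close> see the deliveries from \<open>L - i\<close> to \<open>T + L - i\<close>.
    Earlier deliveries vanish, and \<open>T + L - i\<close> is at least \<open>T\<close>.\<close>
  have shift: "A T \<le> (\<Sum>t=L..T+L. a (t - i))" if "i < L" for i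
  proof -
    have "A T \<le> A (T + L - i)"
      using that by (intro mono) auto
    also have "\<dots> = (\<Sum>t=L-i..T+L-i. a t)"
      unfolding A_def using that a(2) by (intro sum.mono_neutral_right) auto
    also have "\<dots> = (\<Sum>t=L..T+L. a (t - i))"
      by (rule sum.reindex_bij_witness[of _ "\<lambda>t. t - i" "\<lambda>t. t + i"]) (use that in auto)
    finally show ?thesis .
  qed
  have "real (T + 1) * (w - r * Q) + Q * A T =
      (\<Sum>t=L..T+L. w - r * Q) + (\<Sum>i<L. q i * A T)"
    by (simp add: Q_def sum_distrib_right)
  also have "\<dots> \<le> (\<Sum>t=L..T+L. w - r * Q) + (\<Sum>i<L. q i * (\<Sum>t=L..T+L. a (t - i)))"
    using shift q by (intro add_left_mono sum_mono mult_left_mono) auto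
  also have "(\<Sum>i<L. q i * (\<Sum>t=L..T+L. a (t - i))) = (\<Sum>t=L..T+L. \<Sum>i<L. q i * a (t - i))"
    unfolding sum_distrib_left by (rule sum.swap)
  also have "(\<Sum>t=L..T+L. w - r * Q) + (\<Sum>t=L..T+L. \<Sum>i<L. q i * a (t - i))
      = (\<Sum>t=L..T+L. w + (\<Sum>i<L. q i * (a (t - i) - r)))"
    unfolding sum.distrib[symmetric]
    by (simp add: Q_def right_diff_distrib sum_subtractf sum_distrib_left algebra_simps)
  also have "\<dots> \<le> (\<Sum>t=L..T+L. b (Suc t))"
    using w by (intro sum_mono) auto
  also have "\<dots> \<le> (\<Sum>t=1..T+L. b (Suc t))"
    by (rule sum_mono2) (use b \<open>1 \<le> L\<close> in auto)
  finally have hold: "real (T + 1) * (w - r * Q) + Q * A T \<le> (\<Sum>t=1..T+L. b (Suc t))" .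
  have "h * real (T + 1) * (w - r * Q) + h * Q * m * T
      \<le> h * (real (T + 1) * (w - r * Q) + Q * A T) + p * (b (Suc T) - A T + m * T)"
  proof -
    \<comment> \<open>The point where deliveries drop out. An excess over expected demand is bounded
      by the final stock, via \<open>bA\<close>; each unit of shortfall saves \<open>h * Q\<close>
      in holding but costs \<open>p\<close>, which is at least as much.\<close>
    have "(h * Q) * (A T - m * T) + p * (b (Suc T) - (A T - m * T)) \<ge> 0"
    proof (cases "0 \<le> A T - m * T")
      case True
      have "0 \<le> Q"
        using q by (simp add: Q_def sum_nonneg)
      then show ?thesis
        using True bA[of T] assms(1,2) by (intro add_nonneg_nonneg mult_nonneg_nonneg) auto
    next
      case False
      have "(p - h * Q) * (m * T - A T) \<ge> 0"
        using False le by (intro mult_nonneg_nonneg) (auto simp: Q_def)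
      moreover have "p * b (Suc T) \<ge> 0"
        using b assms by simp
      ultimately show ?thesis
        by (simp add: algebra_simps)
    qed
    then show ?thesis
      by (simp add: algebra_simps)
  qed
  also have "\<dots> \<le> h * (\<Sum>t=1..T+L. b (Suc t)) + p * (\<Sum>t=1..T. b (Suc t) - b t - a t + m)"
    unfolding A using hold assms(1) by (intro add_right_mono mult_left_mono)
  also have "\<dots> \<le> h * (\<Sum>t=1..T+L. b (Suc t)) + p * (\<Sum>t=1..T+L. b (Suc t) - b t - a t + m)"
    using bdiff assms(2) by (intro add_left_mono mult_left_mono sum_mono2) auto
  also have "\<dots> = (\<Sum>t=1..T+L. c t)"
    unfolding sum_distrib_left sum.distrib[symmetric] by (intro sum.cong refl) (simp add: c)
  finally show ?thesis
    unfolding Q_def .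
qed

lemma sum_power_tail_le:
  fixes x :: real
  assumes "0 \<le> x" "x < 1"
  shows "(\<Sum>k=Suc L..N. x ^ k) \<le> x ^ Suc L / (1 - x)"
proof (cases "Suc L \<le> N")
  case True
  have "(\<Sum>k=Suc L..N. x ^ k) = (x ^ Suc L - x ^ Suc N) / (1 - x)"
    using True assms by (simp add: sum_gp)
  also have "\<dots> \<le> x ^ Suc L / (1 - x)"
    using assms by (intro divide_right_mono) auto
  finally show ?thesis .
qed (use assms in auto)

lemma sum_split: "L \<le> N \<Longrightarrow> (\<Sum>k=1..N. u k) = (\<Sum>k=1..L. u k) + (\<Sum>k=Suc L..N. u k :: real)"
  using sum.ub_add_nat[of 1 L u "N - L"] by simp

text \<open>Here \<open>x\<close> may be negative: in the final estimate it is a lower bound on the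
  optimal cost whose sign is unknown.\<close>

lemma ennreal_add_le: "0 \<le> y \<Longrightarrow> ennreal (x + y) \<le> ennreal x + ennreal y"
  by (cases "0 \<le> x") (auto simp: ennreal_neg intro: ennreal_leI)

section \<open>Lower bounds for admissible policies\<close>

context iid_demand
begin

lemma mean_nonneg: "0 \<le> mean"
  unfolding mean_def by (rule integral_nonneg_AE) (rule D_nonneg)

text \<open>The state at time \<open>s\<close> is a function of the demands before \<open>s\<close>,
  a block disjoint from \<open>{s..u}\<close>.\<close>

lemma indep_state:
  assumes "f \<in> admissible L" "1 \<le> L" "1 \<le> s"
    and F: "F \<in> borel_measurable (state_space L)" and \<kappa>: "\<kappa> \<in> borel_measurable (PiM {s..u} (\<lambda>_. borel))"
  shows "indep_var borel (\<lambda>\<omega>. \<kappa> (restrict (\<lambda>i. d i \<omega>) {s..u}) :: real) borel (\<lambda>\<omega>. F (state d L f s \<omega>) :: real)"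
proof -
  \<comment> \<open>The state is rebuilt on the product space, with the coordinate projections as
    demands.\<close>
  let ?F = "\<lambda>z. F (state (\<lambda>i z. z i) L f s z)"
  have ind: "indep_var (PiM {s..u} (\<lambda>_. borel)) (\<lambda>\<omega>. restrict (\<lambda>i. d i \<omega>) {s..u})
      (PiM {1..<s} (\<lambda>_. borel)) (\<lambda>\<omega>. restrict (\<lambda>i. d i \<omega>) {1..<s})"
    using assms by (intro indep_var_restrict[OF d_indep]) auto
  have "state (\<lambda>i z. z i) L f s \<in> PiM {1..<s} (\<lambda>_. borel) \<rightarrow>\<^sub>M state_space L"
    using assms by (intro measurable_state) auto
  then have meas: "?F \<in> borel_measurable (PiM {1..<s} (\<lambda>_. borel))"
    by (rule measurable_compose[OF _ F])
  have "state (\<lambda>i z. z i) L f s (restrict (\<lambda>i. d i \<omega>) {1..<s}) = state d L f s \<omega>" for \<omega>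
    by (rule state_demand_cong) simp
  then show ?thesis
    using indep_var_compose[OF ind \<kappa> meas] by (simp add: comp_def)
qed

text \<open>Reads the times \<open>t, t - 1, ..., 1\<close> backwards and continues with
  \<open>t + 1, t + 2, ...\<close>; the continuation makes it an injection on all naturals.\<close>

definition rev_time :: "nat \<Rightarrow> nat \<Rightarrow> nat" where
  "rev_time t i = (if i < t then t - i else Suc i)"

lemma rev_time: "inj (rev_time t)" "range (rev_time t) \<subseteq> {1..}"
  by (auto simp: inj_def rev_time_def split: if_splits)

lemma rev_time_ge: "1 \<le> rev_time t i"
  by (auto simp: rev_time_def)

lemma d_rev_time_measurable [measurable]: "d (rev_time t i) \<in> borel_measurable M"
  by (rule d_measurable) (rule rev_time_ge)

text \<open>The tail \<open>P (J > i)\<close> of the maximizing index: the weight with which the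
  delivery at lag \<open>i\<close> enters the inventory bound. The weights sum to
  \<open>E J\<close>.\<close>

definition stay_prob :: "bool \<Rightarrow> nat \<Rightarrow> nat \<Rightarrow> real \<Rightarrow> real" where
  "stay_prob b n i r = expectation (\<lambda>\<omega>. of_bool (i < walk_argmax b n (\<lambda>j. r - d (Suc j) \<omega>)))"

lemma stay_prob_nonneg: "0 \<le> stay_prob b n i r"
  unfolding stay_prob_def by (rule Bochner_Integration.integral_nonneg) simp

lemma integrable_of_bool:
  "Measurable.pred M P \<Longrightarrow> integrable M (\<lambda>\<omega>. of_bool (P \<omega>) :: real)"
  by (rule integrable_const_bound[where B = 1]) auto

lemma pred_argmax:
  assumes "\<And>j. Y j \<in> borel_measurable N"
  shows "Measurable.pred N (\<lambda>\<omega>. i < walk_argmax b n (\<lambda>j. Y j \<omega>))"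
  using measurable_walk_argmax[of Y N b n, OF assms] by measurable

lemma sum_stay_prob: "(\<Sum>i<n. stay_prob b n i r) = (\<Sum>k=1..n. hit_prob b k r)"
proof -
  have eq: "(\<Sum>i<n. of_bool (i < J)) = real J" if "J \<le> n" for J
  proof -
    have "(\<Sum>i<n. of_bool (i < J)) = (\<Sum>i<J. 1 :: real)"
      using that by (intro sum.mono_neutral_cong_right) auto
    then show ?thesis
      by simp
  qed
  have "(\<Sum>i<n. stay_prob b n i r)
      = expectation (\<lambda>\<omega>. \<Sum>i<n. of_bool (i < walk_argmax b n (\<lambda>j. r - d (Suc j) \<omega>)))"
    unfolding stay_prob_def
    by (intro Bochner_Integration.integral_sum[symmetric] integrable_of_bool pred_argmax) measurable
  then show ?thesis
    by (simp only: eq[OF walk_argmax_le] expectation_walk_argmax)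
qed

lemma expectation_rev_time:
  assumes "H \<in> borel_measurable (PiM UNIV (\<lambda>_. borel))"
  shows "expectation (\<lambda>\<omega>. H (\<lambda>i. d (rev_time t i) \<omega>) :: real) = expectation (\<lambda>\<omega>. H (\<lambda>i. d (Suc i) \<omega>))"
  by (rule expectation_reindex[OF rev_time assms])

lemma expectation_walk_max_rev_time: "expectation (\<lambda>\<omega>. walk_max n (\<lambda>j. r - d (rev_time t j) \<omega>)) = \<mu> n r"
  unfolding \<mu>_def
  by (rule expectation_rev_time[where H = "\<lambda>z. walk_max n (\<lambda>j. r - z j)"])
     (intro borel_measurable_walk_max, measurable)

lemma expectation_argmax_rev_time:
  "expectation (\<lambda>\<omega>. of_bool (i < walk_argmax b n (\<lambda>j. r - d (rev_time t j) \<omega>))) = stay_prob b n i r"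
proof -
  have "Measurable.pred (PiM UNIV (\<lambda>_. borel)) (\<lambda>z. i < walk_argmax b n (\<lambda>j. r - z j))"
    by (rule pred_argmax) measurable
  then have "(\<lambda>z. of_bool (i < walk_argmax b n (\<lambda>j. r - z j)) :: real)
      \<in> borel_measurable (PiM UNIV (\<lambda>_. borel))"
    by measurable
  then show ?thesis
    unfolding stay_prob_def
    by (rule expectation_rev_time[where H = "\<lambda>z. of_bool (i < walk_argmax b n (\<lambda>j. r - z j))"])
qed

text \<open>The order arriving at time \<open>t - i\<close> was placed before the demands that determine the
  maximizing index were realized.\<close>

lemma expectation_argmax_delivery:
  assumes f: "f \<in> admissible L" and L: "1 \<le> L" "L \<le> t" and i: "i < L"
    and int: "integrable M (delivery d L f (t - i))"
  shows "expectation (\<lambda>\<omega>. of_bool (i < walk_argmax b L (\<lambda>j. r - d (rev_time t j) \<omega>)) * delivery d L f (t - i) \<omega>)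
      = stay_prob b L i r * expectation (delivery d L f (t - i))"
    and "integrable M (\<lambda>\<omega>. of_bool (i < walk_argmax b L (\<lambda>j. r - d (rev_time t j) \<omega>)) * delivery d L f (t - i) \<omega>)"
proof -
  let ?J = "\<lambda>\<omega>. of_bool (i < walk_argmax b L (\<lambda>j. r - d (rev_time t j) \<omega>)) :: real"
  have pred: "Measurable.pred M (\<lambda>\<omega>. i < walk_argmax b L (\<lambda>j. r - d (rev_time t j) \<omega>))"
    by (rule pred_argmax) measurable
  have "indep_var borel ?J borel (delivery d L f (t - i))" if less: "L < t - i"
  proof -
    \<comment> \<open>The time at which the order arriving at \<open>t - i\<close> was placed. As
      \<open>s \<le> t - L\<close>, the demands at \<open>t - j\<close> with \<open>j < L\<close>
      all lie in \<open>{s..t}\<close>, whereas the order depends on demands before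
      \<open>s\<close>.\<close>
    define s where "s = t - i - L"
    let ?N = "PiM {s..t} (\<lambda>_. borel :: real measure)"
    \<comment> \<open>The argument of \<open>walk_argmax\<close> is an infinite sequence, but only
      coordinates in \<open>{s..t}\<close> exist; it is padded with zeros from \<open>L\<close> on,
      where it is not inspected.\<close>
    define \<kappa> where "\<kappa> z = (of_bool (i < walk_argmax b L (\<lambda>j. r - (if j < L then z (t - j) else 0))) :: real)"
      for z :: "nat \<Rightarrow> real"
    have s: "1 \<le> s"
      using less by (simp add: s_def)
    have "(\<lambda>z. r - (if j < L then z (t - j) else 0)) \<in> borel_measurable ?N" for j
    proof (cases "j < L")
      case True
      then have "t - j \<in> {s..t}"
        using L less by (auto simp: s_def)
      then have "(\<lambda>z. z (t - j)) \<in> borel_measurable ?N"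
        by (rule measurable_component_singleton)
      then show ?thesis
        using True by simp
    qed simp
    then have "Measurable.pred ?N (\<lambda>z. i < walk_argmax b L (\<lambda>j. r - (if j < L then z (t - j) else 0)))"
      by (rule pred_argmax)
    then have \<kappa>: "\<kappa> \<in> borel_measurable ?N"
      unfolding \<kappa>_def by measurable
    have "f s \<in> state_space L \<rightarrow>\<^sub>M restrict_space borel {0..}"
      using f s by (auto simp: admissible_def)
    then have fs: "f s \<in> borel_measurable (state_space L)"
      by (simp add: measurable_nonneg_real)
    have "indep_var borel (\<lambda>\<omega>. \<kappa> (restrict (\<lambda>i. d i \<omega>) {s..t})) borel (\<lambda>\<omega>. f s (state d L f s \<omega>))"
      by (rule indep_state[OF f L(1) s fs \<kappa>])
    moreover have "(\<lambda>\<omega>. f s (state d L f s \<omega>)) = delivery d L f (t - i)"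
      using less L by (auto simp: fun_eq_iff delivery_eq s_def simp del: One_nat_def)
    moreover have "\<kappa> (restrict (\<lambda>i. d i \<omega>) {s..t}) = ?J \<omega>" for \<omega>
    proof -
      have "walk_argmax b L (\<lambda>j. r - (if j < L then restrict (\<lambda>i. d i \<omega>) {s..t} (t - j) else 0))
          = walk_argmax b L (\<lambda>j. r - d (rev_time t j) \<omega>)"
        using L less by (intro walk_argmax_cong) (auto simp: rev_time_def s_def)
      then show ?thesis
        unfolding \<kappa>_def by simp
    qed
    ultimately show ?thesis
      by simp
  qed
  note ind = indep_var_lebesgue_integral[OF this integrable_of_bool[OF pred] int]
    indep_var_integrable[OF this integrable_of_bool[OF pred] int]
  \<comment> \<open>Such a delivery comes from the empty initial pipeline, so both sides of the
    product formula are 0.\<close>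
  have zero: "delivery d L f (t - i) \<omega> = 0" if "\<not> L < t - i" for \<omega>
    using delivery_eq[of "t - i" L d f \<omega>] that L i by simp
  show "expectation (\<lambda>\<omega>. ?J \<omega> * delivery d L f (t - i) \<omega>)
      = stay_prob b L i r * expectation (delivery d L f (t - i))"
    using ind(1) zero by (cases "L < t - i") (auto simp: expectation_argmax_rev_time)
  show "integrable M (\<lambda>\<omega>. ?J \<omega> * delivery d L f (t - i) \<omega>)"
    using ind(2) zero by (cases "L < t - i") auto
qed

text \<open>Writing delivery minus demand as \<open>r\<close> minus demand plus delivery minus
  \<open>r\<close>, the first parts add up to the maximum of the reversed walk with drift
  \<open>r\<close>, and the second parts factor by independence.\<close>

lemma expectation_inventory_ge:
  assumes f: "f \<in> admissible L" and L: "1 \<le> L" "L \<le> t"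
    and int: "\<And>s. 1 \<le> s \<Longrightarrow> integrable M (delivery d L f s)" "integrable M (inventory d L f (Suc t))"
  shows "\<mu> L r + (\<Sum>i<L. stay_prob b L i r * (expectation (delivery d L f (t - i)) - r))
    \<le> expectation (inventory d L f (Suc t))"
proof -
  let ?J = "\<lambda>\<omega>. walk_argmax b L (\<lambda>j. r - d (rev_time t j) \<omega>)"
  let ?W = "\<lambda>\<omega>. walk_max L (\<lambda>j. r - d (rev_time t j) \<omega>)"
  let ?x = "\<lambda>i \<omega>. of_bool (i < ?J \<omega>) * delivery d L f (t - i) \<omega>"
  have le: "?W \<omega> + (\<Sum>i<L. ?x i \<omega> - of_bool (i < ?J \<omega>) * r) \<le> inventory d L f (Suc t) \<omega>" for \<omega>
  proof -
    have J: "?J \<omega> \<le> L"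
      by (rule walk_argmax_le)
    have "(\<Sum>i<L. ?x i \<omega> - of_bool (i < ?J \<omega>) * r) = (\<Sum>i<?J \<omega>. delivery d L f (t - i) \<omega> - r)"
      using J by (intro sum.mono_neutral_cong_right) auto
    moreover have "?W \<omega> = (\<Sum>i<?J \<omega>. r - d (t - i) \<omega>)"
      unfolding sum_walk_argmax[where b = b, symmetric]
      using J L by (intro sum.cong refl) (auto simp: rev_time_def)
    ultimately have "?W \<omega> + (\<Sum>i<L. ?x i \<omega> - of_bool (i < ?J \<omega>) * r)
        = (\<Sum>i<?J \<omega>. delivery d L f (t - i) \<omega> - d (t - i) \<omega>)"
      by (simp add: sum.distrib[symmetric])
    also have "\<dots> \<le> inventory d L f (Suc t) \<omega>"
      using inventory_ge_sum[of "?J \<omega>" t d L f \<omega>] inventory_nonneg[of d L f "Suc t - ?J \<omega>" \<omega>] J L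
      by linarith
    finally show ?thesis .
  qed
  have W: "integrable M ?W"
    by (rule integrable_walk_max) (simp add: integrable_d rev_time_ge del: One_nat_def)
  have x: "integrable M (?x i)" "expectation (?x i) = stay_prob b L i r * expectation (delivery d L f (t - i))"
    if "i < L" for i
    using expectation_argmax_delivery[OF f L that int(1)] that L by auto
  have J: "integrable M (\<lambda>\<omega>. of_bool (i < ?J \<omega>) :: real)" for i
    by (intro integrable_of_bool pred_argmax) measurable
  have summand: "expectation (\<lambda>\<omega>. ?x i \<omega> - of_bool (i < ?J \<omega>) * r)
      = stay_prob b L i r * (expectation (delivery d L f (t - i)) - r)"
    "integrable M (\<lambda>\<omega>. ?x i \<omega> - of_bool (i < ?J \<omega>) * r)" if "i < L" for i
    using x[OF that] J[of i] by (simp_all add: expectation_argmax_rev_time right_diff_distrib)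
  have S: "integrable M (\<lambda>\<omega>. \<Sum>i<L. ?x i \<omega> - of_bool (i < ?J \<omega>) * r)"
    by (rule Bochner_Integration.integrable_sum) (simp only: lessThan_iff, rule summand(2))
  have "(\<Sum>i<L. stay_prob b L i r * (expectation (delivery d L f (t - i)) - r))
      = (\<Sum>i<L. expectation (\<lambda>\<omega>. ?x i \<omega> - of_bool (i < ?J \<omega>) * r))"
    by (intro sum.cong refl) (simp only: lessThan_iff summand(1))
  also have "\<dots> = expectation (\<lambda>\<omega>. \<Sum>i<L. ?x i \<omega> - of_bool (i < ?J \<omega>) * r)"
    by (rule Bochner_Integration.integral_sum[symmetric]) (simp only: lessThan_iff, rule summand(2))
  finally have "\<mu> L r + (\<Sum>i<L. stay_prob b L i r * (expectation (delivery d L f (t - i)) - r))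
      = expectation (\<lambda>\<omega>. ?W \<omega> + (\<Sum>i<L. ?x i \<omega> - of_bool (i < ?J \<omega>) * r))"
    by (simp only: Bochner_Integration.integral_add[OF W S] expectation_walk_max_rev_time)
  also have "\<dots> \<le> expectation (inventory d L f (Suc t))"
    by (intro integral_mono Bochner_Integration.integrable_add W S int(2) le)
  finally show ?thesis .
qed

lemma borel_measurable_inventory_delivery:
  assumes "f \<in> admissible L" "1 \<le> L" "1 \<le> t"
  shows "inventory d L f t \<in> borel_measurable M" "delivery d L f t \<in> borel_measurable M"
proof -
  have s: "state d L f t \<in> M \<rightarrow>\<^sub>M state_space L"
    using assms by (intro measurable_state) (auto intro: d_measurable)
  show "inventory d L f t \<in> borel_measurable M"
    using measurable_compose[OF s measurable_snd_state_space] by (simp add: measurable_nonneg_real)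
  show "delivery d L f t \<in> borel_measurable M"
    using measurable_compose[OF s measurable_fst_state_space[of 1 L]] assms
    by (simp add: measurable_nonneg_real)
qed

lemma delivery_nonneg:
  assumes "f \<in> admissible L" "1 \<le> L" "1 \<le> t" "\<omega> \<in> space M"
  shows "0 \<le> delivery d L f t \<omega>"
proof -
  have s: "state d L f t \<in> M \<rightarrow>\<^sub>M state_space L"
    using assms by (intro measurable_state) (auto intro: d_measurable)
  show ?thesis
    using measurable_compose[OF s measurable_fst_state_space[of 1 L]] assms
    by (simp add: measurable_nonneg_real)
qed

lemma average_cost_infinite:
  assumes "1 \<le> t" "(\<integral>\<^sup>+\<omega>. ennreal (period_cost d h p L f t \<omega>) \<partial>M) = \<infinity>"
  shows "average_cost M d h p L f = \<infinity>"
proof -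
  have "(\<Sum>s=1..T. \<integral>\<^sup>+\<omega>. ennreal (period_cost d h p L f s \<omega>) \<partial>M) / of_nat T = \<infinity>"
    if "t \<le> T" for T
  proof -
    have "(\<integral>\<^sup>+\<omega>. ennreal (period_cost d h p L f t \<omega>) \<partial>M)
        \<le> (\<Sum>s=1..T. \<integral>\<^sup>+\<omega>. ennreal (period_cost d h p L f s \<omega>) \<partial>M)"
      using assms(1) that by (intro member_le_sum) auto
    then have "(\<Sum>s=1..T. \<integral>\<^sup>+\<omega>. ennreal (period_cost d h p L f s \<omega>) \<partial>M) = \<infinity>"
      unfolding assms(2) by (simp only: infinity_ennreal_def top_unique)
    then show ?thesis
      by (simp only:) (simp add: ennreal_top_divide)
  qed
  then have "eventually (\<lambda>T. (\<Sum>s=1..T. \<integral>\<^sup>+\<omega>. ennreal (period_cost d h p L f s \<omega>) \<partial>M) / of_nat T = \<infinity>)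
      sequentially"
    by (auto simp: eventually_sequentially)
  then show ?thesis
    unfolding average_cost_def by (subst Limsup_eq) (auto simp: Limsup_const)
qed

text \<open>Dividing the finite-horizon bound by the horizon leaves its linear growth rate. A policy
  with an infinite expected cost in some period satisfies the bound at once; for all others the
  expectations below are finite.\<close>

lemma average_cost_ge:
  assumes f: "f \<in> admissible L" and "0 < h" "0 < p" and L: "1 \<le> L"
    and v: "0 \<le> v" "v \<le> 1"
    and Q: "Q = v * (\<Sum>k=1..L. hit_prob True k r) + (1 - v) * (\<Sum>k=1..L. hit_prob False k r)"
    and le: "h * Q \<le> p"
  shows "ennreal (h * \<mu> L r + h * Q * (mean - r)) \<le> average_cost M d h p L f"
proof (cases "\<exists>t\<ge>1. (\<integral>\<^sup>+\<omega>. ennreal (period_cost d h p L f t \<omega>) \<partial>M) = \<infinity>")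
  case True
  then show ?thesis
    using average_cost_infinite by fastforce
next
  case False
  define c where "c t = expectation (period_cost d h p L f t)" for t
  define b where "b t = expectation (inventory d L f t)" for t
  define a where "a t = expectation (delivery d L f t)" for t
  define q where "q i = v * stay_prob True L i r + (1 - v) * stay_prob False L i r" for i
  note meas = borel_measurable_inventory_delivery[OF f L]
  have hp: "0 \<le> h" "0 \<le> p"
    using assms by auto
  have cost_meas: "period_cost d h p L f t \<in> borel_measurable M" if "1 \<le> t" for t
  proof -
    have [measurable]: "inventory d L f t \<in> borel_measurable M"
        "inventory d L f (Suc t) \<in> borel_measurable M"
        "delivery d L f t \<in> borel_measurable M" "d t \<in> borel_measurable M"
      using meas that d_measurable by auto
    show ?thesis
      unfolding period_cost_eq[OF that, abs_def] by measurable
  qed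
  have cost_int: "integrable M (period_cost d h p L f t)" if "1 \<le> t" for t
    using False that cost_meas[OF that]
    by (intro integrableI_nonneg) (auto simp: top.not_eq_extremum period_cost_nonneg[OF hp])
  \<comment> \<open>Finite expected cost bounds the expected inventory because \<open>h > 0\<close>;
    a delivery is then bounded by the next inventory plus the demand.\<close>
  have inv_Suc: "integrable M (inventory d L f (Suc t))" if "1 \<le> t" for t
  proof (rule Bochner_Integration.integrable_bound)
    show "integrable M (\<lambda>\<omega>. period_cost d h p L f t \<omega> / h)"
      using cost_int[OF that] by simp
    show "inventory d L f (Suc t) \<in> borel_measurable M"
      using meas by simp
    show "AE \<omega> in M. norm (inventory d L f (Suc t) \<omega>) \<le> norm (period_cost d h p L f t \<omega> / h)"
      using period_cost_ge[OF that hp(2), of h d L f] \<open>0 < h\<close> inventory_nonneg[of d L f "Suc t"]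
      by (auto intro!: AE_I2 order_trans[OF _ abs_ge_self] simp: field_simps)
  qed
  have inv: "integrable M (inventory d L f t)" if "1 \<le> t" for t
    using inv_Suc[of "t - 1"] that by (cases "t = 1") (auto simp: state_1)
  have del: "integrable M (delivery d L f t)" if "1 \<le> t" for t
  proof (rule Bochner_Integration.integrable_bound)
    show "integrable M (\<lambda>\<omega>. inventory d L f (Suc t) \<omega> + d t \<omega>)"
      using inv_Suc[OF that] integrable_d[OF that] by simp
    show "delivery d L f t \<in> borel_measurable M"
      using meas that by simp
    show "AE \<omega> in M. norm (delivery d L f t \<omega>) \<le> norm (inventory d L f (Suc t) \<omega> + d t \<omega>)"
    proof (rule AE_I2)
      fix \<omega> assume "\<omega> \<in> space M"
      then show "norm (delivery d L f t \<omega>) \<le> norm (inventory d L f (Suc t) \<omega> + d t \<omega>)"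
        using delivery_nonneg[OF f L that] inventory_nonneg[of d L f t \<omega>] inventory_Suc[OF that, of d L f \<omega>]
        by (auto simp del: One_nat_def)
    qed
  qed
  have sum_q: "(\<Sum>i<L. q i) = Q"
    by (simp add: q_def Q sum.distrib sum_distrib_left[symmetric] sum_stay_prob)
  have bound: "h * real (T + 1) * (\<mu> L r - r * (\<Sum>i<L. q i)) + h * (\<Sum>i<L. q i) * mean * T
      \<le> (\<Sum>t=1..T+L. c t)" for T
  proof (rule cost_sum_lower_bound[OF hp])
    show "0 \<le> a t" if "1 \<le> t" for t
      unfolding a_def using delivery_nonneg[OF f L that] by (rule Bochner_Integration.integral_nonneg)
    show "a t = 0" if "1 \<le> t" "t \<le> L" for t
      unfolding a_def using that L by (subst delivery_eq) auto
    show "b (Suc 0) = 0"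
      by (simp add: b_def state_1)
    show "0 \<le> b t" for t
      unfolding b_def by (simp add: inventory_nonneg)
    show "0 \<le> b (Suc t) - b t - a t + mean" if "1 \<le> t" for t
    proof -
      have "0 \<le> expectation (\<lambda>\<omega>. inventory d L f (Suc t) \<omega> - inventory d L f t \<omega> - delivery d L f t \<omega> + d t \<omega>)"
        using that by (intro Bochner_Integration.integral_nonneg) (simp add: inventory_Suc)
      then show ?thesis
        using inv[OF that] inv_Suc[OF that] del[OF that] integrable_d[OF that] expectation_d[OF that]
        by (simp add: a_def b_def)
    qed
    show "c t = h * b (Suc t) + p * (b (Suc t) - b t - a t + mean)" if "1 \<le> t" for t
      unfolding c_def period_cost_eq[OF that, abs_def]
      using inv[OF that] inv_Suc[OF that] del[OF that] integrable_d[OF that] expectation_d[OF that]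
      by (simp add: a_def b_def)
    show "\<mu> L r + (\<Sum>i<L. q i * (a (t - i) - r)) \<le> b (Suc t)" if "L \<le> t" for t
    proof -
      \<comment> \<open>The bound holds for each tie rule, hence for the convex combination with
        weights \<open>v\<close> and \<open>1 - v\<close>.\<close>
      have "\<mu> L r + (\<Sum>i<L. stay_prob \<beta> L i r * (a (t - i) - r)) \<le> b (Suc t)" for \<beta>
        unfolding a_def b_def using expectation_inventory_ge[OF f L that del inv_Suc] L that by auto
      then have "v * (\<mu> L r + (\<Sum>i<L. stay_prob True L i r * (a (t - i) - r)))
          + (1 - v) * (\<mu> L r + (\<Sum>i<L. stay_prob False L i r * (a (t - i) - r)))
          \<le> v * b (Suc t) + (1 - v) * b (Suc t)"
        using v by (intro add_mono mult_left_mono) auto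
      then show ?thesis
        by (simp add: q_def sum.distrib sum_distrib_left algebra_simps sum_subtractf)
    qed
    show "0 \<le> q i" for i
      using v stay_prob_nonneg by (simp add: q_def)
    show "h * (\<Sum>i<L. q i) \<le> p"
      using le by (simp add: sum_q)
  qed (fact L)
  let ?X = "\<lambda>T. (\<Sum>t=1..T. \<integral>\<^sup>+\<omega>. ennreal (period_cost d h p L f t \<omega>) \<partial>M) / of_nat T"
  \<comment> \<open>The horizon is \<open>T + L\<close>, so the averages are compared along a
    shifted subsequence, whose limsup is at most the full one.\<close>
  define lb where "lb T = (h * real (T + 1) * (\<mu> L r - r * Q) + h * Q * mean * T) / real (T + L)" for T
  have X: "?X (T + L) = ennreal ((\<Sum>t=1..T+L. c t) / real (T + L))" for T
  proof -
    have "(\<Sum>t=1..T+L. \<integral>\<^sup>+\<omega>. ennreal (period_cost d h p L f t \<omega>) \<partial>M) = (\<Sum>t=1..T+L. ennreal (c t))"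
      unfolding c_def
      by (intro sum.cong refl nn_integral_eq_integral)
        (auto intro!: cost_int AE_I2 period_cost_nonneg[OF hp])
    also have "\<dots> = ennreal (\<Sum>t=1..T+L. c t)"
      by (rule sum_ennreal) (auto simp: c_def period_cost_nonneg[OF hp])
    finally show ?thesis
      using L by (simp add: ennreal_of_nat_eq_real_of_nat c_def period_cost_nonneg[OF hp] sum_nonneg
          divide_ennreal del: of_nat_add)
  qed
  have ratio: "(\<lambda>T. real T / real (T + L)) \<longlonglongrightarrow> 1"
  proof -
    have "(\<lambda>T. 1 - real L / real (T + L)) \<longlonglongrightarrow> 1 - 0"
      by (intro tendsto_intros LIMSEQ_ignore_initial_segment[OF lim_const_over_n])
    moreover have "1 - real L / real (T + L) = real T / real (T + L)" for T
      using L by (simp add: field_simps)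
    ultimately show ?thesis
      by simp
  qed
  have ratio1: "(\<lambda>T. real (T + 1) / real (T + L)) \<longlonglongrightarrow> 1"
  proof -
    have "(\<lambda>T. real T / real (T + L) + 1 / real (T + L)) \<longlonglongrightarrow> 1 + 0"
      by (intro tendsto_add ratio LIMSEQ_ignore_initial_segment[OF lim_const_over_n[of 1, simplified]])
    then show ?thesis
      by (simp add: add_divide_distrib[symmetric] add.commute)
  qed
  have "(\<lambda>T. h * (\<mu> L r - r * Q) * (real (T + 1) / real (T + L)) + h * Q * mean * (real T / real (T + L)))
      \<longlonglongrightarrow> h * (\<mu> L r - r * Q) * 1 + h * Q * mean * 1"
    by (intro tendsto_intros ratio ratio1)
  also have "h * (\<mu> L r - r * Q) * 1 + h * Q * mean * 1 = h * \<mu> L r + h * Q * (mean - r)"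
    by (simp add: algebra_simps)
  also have "(\<lambda>T. h * (\<mu> L r - r * Q) * (real (T + 1) / real (T + L)) + h * Q * mean * (real T / real (T + L)))
      = lb"
    by (simp add: fun_eq_iff lb_def add_divide_distrib[symmetric] times_divide_eq_right mult_ac
        del: of_nat_add)
  finally have "(\<lambda>T. ennreal (lb T)) \<longlonglongrightarrow> ennreal (h * \<mu> L r + h * Q * (mean - r))"
    by (rule tendsto_ennrealI)
  then have "ennreal (h * \<mu> L r + h * Q * (mean - r)) = limsup (\<lambda>T. ennreal (lb T))"
    by (intro lim_imp_Limsup[symmetric]) auto
  also have "\<dots> \<le> limsup (?X \<circ> (\<lambda>T. T + L))"
    unfolding comp_def X lb_def using bound L
    by (intro Limsup_mono always_eventually allI ennreal_leI divide_right_mono) (auto simp: sum_q)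
  also have "\<dots> \<le> limsup ?X"
    by (rule limsup_subseq_mono) (simp add: strict_mono_def)
  finally show ?thesis
    unfolding average_cost_def .
qed

section \<open>The newsvendor bound on the cost of any policy\<close>

lemma newsvendor_opt_le:
  assumes "0 \<le> h" "0 \<le> p"
  shows "newsvendor_opt M D h p \<le> expectation (\<lambda>\<omega>. newsvendor_cost h p (x - D \<omega>))"
  unfolding newsvendor_opt_def
proof (rule cINF_lower)
  show "bdd_below (range (\<lambda>x. expectation (\<lambda>\<omega>. newsvendor_cost h p (x - D \<omega>))))"
    using assms
    by (intro bdd_belowI[of _ 0]) (auto simp: newsvendor_cost_def intro!: Bochner_Integration.integral_nonneg)
qed simp

lemma integrable_newsvendor_cost: "integrable M (\<lambda>\<omega>. newsvendor_cost h p (x - D \<omega>))"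
  unfolding newsvendor_cost_def using D_integrable by simp

text \<open>The stock \<open>Y\<close> available in period \<open>t\<close> is independent of the
  demand of that period. For each fixed value of \<open>Y\<close> the expected cost is at least
  \<open>g\<close>; Tonelli's theorem integrates this over \<open>Y\<close>.\<close>

lemma newsvendor_opt_le_period_cost:
  assumes f: "f \<in> admissible L" and "0 \<le> h" "0 \<le> p" and L: "1 \<le> L" and t: "1 \<le> t"
  shows "ennreal (newsvendor_opt M D h p) \<le> (\<integral>\<^sup>+\<omega>. ennreal (period_cost d h p L f t \<omega>) \<partial>M)"
proof -
  define Y where "Y \<omega> = inventory d L f t \<omega> + delivery d L f t \<omega>" for \<omega>
  let ?N = "distr M borel Y"
  let ?P = "distr M borel (d t)"
  have [measurable]: "Y \<in> borel_measurable M" "d t \<in> borel_measurable M"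
    unfolding Y_def[abs_def]
    using borel_measurable_inventory_delivery[OF f L t] d_measurable[OF t] by auto
  have [measurable]: "newsvendor_cost h p \<in> borel_measurable borel"
    unfolding newsvendor_cost_def[abs_def] by measurable
  have "indep_var borel (\<lambda>\<omega>. restrict (\<lambda>i. d i \<omega>) {t..t} t) borel Y"
    unfolding Y_def[abs_def]
    using measurable_snd_state_space[of L] measurable_fst_state_space[of 1 L] L
    by (intro indep_state[OF f L t, where F = "\<lambda>s. snd s + fst s 1" and \<kappa> = "\<lambda>z. z t"]
        borel_measurable_add measurable_component_singleton) (auto simp: measurable_nonneg_real)
  then have ind: "indep_var borel (d t) borel Y"
    by simp
  interpret N: prob_space ?N
    by (rule prob_space_distr) measurable
  interpret P: prob_space ?P
    by (rule prob_space_distr) measurable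
  interpret PN: pair_sigma_finite ?P ?N ..
  have inner: "ennreal (newsvendor_opt M D h p) \<le> (\<integral>\<^sup>+z. ennreal (newsvendor_cost h p (y - z)) \<partial>?P)" for y
  proof -
    have "ennreal (newsvendor_opt M D h p) \<le> ennreal (expectation (\<lambda>\<omega>. newsvendor_cost h p (y - D \<omega>)))"
      using assms by (intro ennreal_leI newsvendor_opt_le)
    also have "\<dots> = (\<integral>\<^sup>+\<omega>. ennreal (newsvendor_cost h p (y - D \<omega>)) \<partial>M)"
      using assms by (intro nn_integral_eq_integral[symmetric] integrable_newsvendor_cost)
        (auto simp: newsvendor_cost_def)
    also have "\<dots> = (\<integral>\<^sup>+z. ennreal (newsvendor_cost h p (y - z)) \<partial>distr M borel D)"
      by (subst nn_integral_distr) auto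
    finally show ?thesis
      by (simp only: d_distr[OF t])
  qed
  have "ennreal (newsvendor_opt M D h p) = (\<integral>\<^sup>+y. ennreal (newsvendor_opt M D h p) \<partial>?N)"
    by (simp add: N.emeasure_space_1[simplified])
  also have "\<dots> \<le> (\<integral>\<^sup>+y. \<integral>\<^sup>+z. ennreal (newsvendor_cost h p (y - z)) \<partial>?P \<partial>?N)"
    by (intro nn_integral_mono inner)
  also have "\<dots> = (\<integral>\<^sup>+zy. ennreal (newsvendor_cost h p (snd zy - fst zy)) \<partial>(?P \<Otimes>\<^sub>M ?N))"
    by (subst PN.nn_integral_snd[symmetric]) auto
  also have "?P \<Otimes>\<^sub>M ?N = distr M (borel \<Otimes>\<^sub>M borel) (\<lambda>\<omega>. (d t \<omega>, Y \<omega>))"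
    using ind by (subst (asm) indep_var_distribution_eq) auto
  also have "(\<integral>\<^sup>+zy. ennreal (newsvendor_cost h p (snd zy - fst zy)) \<partial>\<dots>)
      = (\<integral>\<^sup>+\<omega>. ennreal (newsvendor_cost h p (Y \<omega> - d t \<omega>)) \<partial>M)"
    by (subst nn_integral_distr) auto
  finally show ?thesis
    by (simp add: period_cost_def case_prod_beta Y_def)
qed

lemma newsvendor_opt_le_average_cost:
  assumes f: "f \<in> admissible L" and "0 \<le> h" "0 \<le> p" and L: "1 \<le> L"
  shows "ennreal (newsvendor_opt M D h p) \<le> average_cost M d h p L f"
proof -
  let ?g = "ennreal (newsvendor_opt M D h p)"
  have "?g \<le> (\<Sum>t=1..T. \<integral>\<^sup>+\<omega>. ennreal (period_cost d h p L f t \<omega>) \<partial>M) / of_nat T" if "1 \<le> T" for T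
  proof -
    have "of_nat T * ?g = (\<Sum>t=1..T. ?g)"
      by simp
    also have "\<dots> \<le> (\<Sum>t=1..T. \<integral>\<^sup>+\<omega>. ennreal (period_cost d h p L f t \<omega>) \<partial>M)"
      using assms by (intro sum_mono newsvendor_opt_le_period_cost) auto
    finally have "of_nat T * ?g / of_nat T \<le> (\<Sum>t=1..T. \<integral>\<^sup>+\<omega>. ennreal (period_cost d h p L f t \<omega>) \<partial>M) / of_nat T"
      by (rule divide_right_mono_ennreal)
    then show ?thesis
      using that by (simp add: ennreal_mult_divide_eq mult.commute[of _ ?g])
  qed
  then have "eventually (\<lambda>T. ?g \<le> (\<Sum>t=1..T. \<integral>\<^sup>+\<omega>. ennreal (period_cost d h p L f t \<omega>) \<partial>M) / of_nat T) sequentially"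
    by (auto simp: eventually_sequentially)
  then have "limsup (\<lambda>T. ?g) \<le> average_cost M d h p L f"
    unfolding average_cost_def by (rule Limsup_mono)
  then show ?thesis
    by (simp add: Limsup_const)
qed

section \<open>Constant-order policies\<close>

lemma AE_all_d_nonneg: "AE \<omega> in M. \<forall>t\<ge>1. 0 \<le> d t \<omega>"
proof -
  have "AE \<omega> in M. \<forall>t. 0 \<le> d (Suc t) \<omega>"
    unfolding AE_all_countable by (intro allI AE_d_nonneg) simp
  then show ?thesis
  proof (rule AE_mp, intro AE_I2 impI allI)
    fix \<omega> t assume "\<forall>t. 0 \<le> d (Suc t) \<omega>" "1 \<le> (t :: nat)"
    then show "0 \<le> d t \<omega>"
      by (cases t) auto
  qed
qed

lemma constant_order_admissible: "0 \<le> r \<Longrightarrow> constant_order r \<in> admissible L"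
  by (auto simp: admissible_def constant_order_def space_restrict_space)

lemma delivery_constant_order:
  "1 \<le> t \<Longrightarrow> 1 \<le> L \<Longrightarrow> delivery d L (constant_order r) t \<omega> = (if L < t then r else 0)"
  by (subst delivery_eq) (auto simp: constant_order_def)

text \<open>The inventory recursion unrolled into the maximum of the time-reversed walk. In the
  first \<open>L\<close> periods nothing arrives, and nonnegative demands keep the stock at 0, which
  matches \<open>s - L = 0\<close>.\<close>

lemma inventory_constant_order:
  assumes "\<forall>t\<ge>1. 0 \<le> d t \<omega>" and L: "1 \<le> L"
  shows "inventory d L (constant_order r) (Suc s) \<omega> = walk_max (s - L) (\<lambda>i. r - d (s - i) \<omega>)"
proof (induction s)
  case 0
  then show ?case
    by (simp add: state_1)
next
  case (Suc s)
  show ?case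
  proof (cases "Suc s \<le> L")
    case True
    then show ?thesis
      using Suc.IH assms
      by (simp add: inventory_Suc[of "Suc s"] delivery_constant_order del: One_nat_def)
  next
    case False
    then have "walk_max (Suc s - L) (\<lambda>i. r - d (Suc s - i) \<omega>)
        = max 0 (r - d (Suc s) \<omega> + walk_max (s - L) (\<lambda>i. r - d (s - i) \<omega>))"
      by (simp add: Suc_diff_le)
    then show ?thesis
      using Suc.IH False L
      by (simp add: inventory_Suc[of "Suc s"] delivery_constant_order add.commute del: One_nat_def)
  qed
qed

lemma expectation_inventory_constant_order:
  assumes "0 \<le> r" and L: "1 \<le> L"
  shows "integrable M (inventory d L (constant_order r) (Suc s))"
    and "expectation (inventory d L (constant_order r) (Suc s)) = \<mu> (s - L) r"
proof -
  let ?W = "\<lambda>\<omega>. walk_max (s - L) (\<lambda>j. r - d (rev_time s j) \<omega>)"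
  have "AE \<omega> in M. inventory d L (constant_order r) (Suc s) \<omega> = ?W \<omega>"
    using AE_all_d_nonneg
  proof (rule AE_mp, intro AE_I2 impI)
    fix \<omega> assume "\<forall>t\<ge>1. 0 \<le> d t \<omega>"
    then have "inventory d L (constant_order r) (Suc s) \<omega> = walk_max (s - L) (\<lambda>i. r - d (s - i) \<omega>)"
      by (rule inventory_constant_order[OF _ L])
    also have "\<dots> = ?W \<omega>"
      by (rule walk_max_cong) (auto simp: rev_time_def)
    finally show "inventory d L (constant_order r) (Suc s) \<omega> = ?W \<omega>" .
  qed
  moreover have "inventory d L (constant_order r) (Suc s) \<in> borel_measurable M"
    using assms by (intro borel_measurable_inventory_delivery constant_order_admissible) auto
  moreover have W: "integrable M ?W"
    by (rule integrable_walk_max) (simp add: integrable_d rev_time_ge del: One_nat_def)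
  ultimately show "integrable M (inventory d L (constant_order r) (Suc s))"
      and "expectation (inventory d L (constant_order r) (Suc s)) = \<mu> (s - L) r"
    using integrable_cong_AE[of "inventory d L (constant_order r) (Suc s)" M ?W]
      integral_cong_AE[of "inventory d L (constant_order r) (Suc s)" M ?W]
      expectation_walk_max_rev_time[of "s - L" r s]
    by auto
qed

text \<open>The inventory differences telescope. Truncated subtraction in \<open>t - L\<close>
  encodes the \<open>L\<close> start-up periods, since \<open>\<mu> 0 r = 0\<close>.\<close>

lemma sum_cost_constant_order:
  assumes "0 \<le> r" "0 \<le> h" "0 \<le> p" and L: "1 \<le> L"
  shows "(\<Sum>t=1..T. \<integral>\<^sup>+\<omega>. ennreal (period_cost d h p L (constant_order r) t \<omega>) \<partial>M) =
    ennreal (h * (\<Sum>t=1..T. \<mu> (t - L) r) + p * (\<mu> (T - L) r - r * real (T - L) + mean * real T))"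
proof -
  let ?f = "constant_order r"
  define c where "c t = h * \<mu> (t - L) r + p * (\<mu> (t - L) r - \<mu> (t - 1 - L) r - (if L < t then r else 0) + mean)"
    for t
  have cost: "(\<integral>\<^sup>+\<omega>. ennreal (period_cost d h p L ?f t \<omega>) \<partial>M) = ennreal (c t)" "0 \<le> c t" if t: "1 \<le> t" for t
  proof -
    note inv = expectation_inventory_constant_order[OF assms(1) L, of t]
      expectation_inventory_constant_order[OF assms(1) L, of "t - 1"]
    have eq: "period_cost d h p L ?f t = (\<lambda>\<omega>. h * inventory d L ?f (Suc t) \<omega> +
        p * (inventory d L ?f (Suc t) \<omega> - inventory d L ?f t \<omega> - (if L < t then r else 0) + d t \<omega>))"
      unfolding period_cost_eq[OF t, abs_def] by (simp only: delivery_constant_order[OF t L])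
    have "Suc (t - 1) = t"
      using t by simp
    then have int: "integrable M (period_cost d h p L ?f t)" and "expectation (period_cost d h p L ?f t) = c t"
      unfolding eq c_def using inv integrable_d[OF t] expectation_d[OF t] by (simp_all add: prob_space)
    moreover have "0 \<le> expectation (period_cost d h p L ?f t)"
      by (rule Bochner_Integration.integral_nonneg) (rule period_cost_nonneg[OF assms(2,3)])
    ultimately show "0 \<le> c t"
      by simp
    show "(\<integral>\<^sup>+\<omega>. ennreal (period_cost d h p L ?f t \<omega>) \<partial>M) = ennreal (c t)"
      unfolding \<open>expectation _ = c t\<close>[symmetric]
      by (intro nn_integral_eq_integral int AE_I2 period_cost_nonneg[OF assms(2,3)])
  qed
  have "(\<Sum>t=1..T. \<integral>\<^sup>+\<omega>. ennreal (period_cost d h p L ?f t \<omega>) \<partial>M) = (\<Sum>t=1..T. ennreal (c t))"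
    by (intro sum.cong refl cost) simp
  also have "\<dots> = ennreal (\<Sum>t=1..T. c t)"
    by (rule sum_ennreal) (use cost in auto)
  also have "(\<Sum>t=1..T. c t) =
      h * (\<Sum>t=1..T. \<mu> (t - L) r) + p * (\<mu> (T - L) r - r * real (T - L) + mean * real T)"
  proof (induction T)
    case (Suc T)
    have "r * real (Suc T - L) = r * real (T - L) + (if L < Suc T then r else 0)"
      by (auto simp: Suc_diff_le algebra_simps not_less_eq)
    then show ?case
      using Suc.IH by (simp add: c_def algebra_simps)
  qed simp
  finally show ?thesis .
qed

lemma surplus_nonneg: "0 \<le> surplus k r"
  unfolding surplus_def by (rule Bochner_Integration.integral_nonneg) simp

lemma \<mu>_mono: "n \<le> n' \<Longrightarrow> \<mu> n r \<le> \<mu> n' r"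
  unfolding \<mu>_eq_sum by (rule sum_mono2) (auto simp: surplus_nonneg)

lemma \<mu>_nonneg: "0 \<le> \<mu> n r"
  using \<mu>_mono[of 0 n r] by simp

text \<open>This and the next bound replace the formula with the supremum of the infinite walk: the
  cost dominates the expression for every finite horizon \<open>N\<close>, and any common bound
  \<open>B\<close> on the \<open>\<mu> N r\<close> bounds it from above.\<close>

lemma average_cost_constant_order_ge:
  assumes "0 \<le> r" "r \<le> mean" "0 \<le> h" "0 \<le> p" and L: "1 \<le> L"
  shows "ennreal (h * \<mu> N r + p * (mean - r)) \<le> average_cost M d h p L (constant_order r)"
proof -
  \<comment> \<open>The first \<open>L + N\<close> periods are discarded; afterwards monotonicity
    gives \<open>\<mu> (t - L) r \<ge> \<mu> N r\<close>.\<close>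
  define lb where "lb T = (h * (\<mu> N r * (real T - real (L + N))) + p * (mean - r) * real T) / real T" for T
  have "(\<lambda>T. h * \<mu> N r + p * (mean - r) - (h * \<mu> N r * real (L + N)) / real T)
      \<longlonglongrightarrow> h * \<mu> N r + p * (mean - r) - 0"
    by (intro tendsto_intros lim_const_over_n)
  moreover have "eventually (\<lambda>T. h * \<mu> N r + p * (mean - r) - (h * \<mu> N r * real (L + N)) / real T = lb T) sequentially"
    using eventually_gt_at_top[of 0]
    by eventually_elim (simp add: lb_def field_simps)
  ultimately have "lb \<longlonglongrightarrow> h * \<mu> N r + p * (mean - r)"
    by (simp add: tendsto_cong)
  then have "ennreal (h * \<mu> N r + p * (mean - r)) = limsup (\<lambda>T. ennreal (lb T))"
    by (intro lim_imp_Limsup[symmetric] tendsto_ennrealI) auto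
  also have "\<dots> \<le> average_cost M d h p L (constant_order r)"
    unfolding average_cost_def
  proof (rule Limsup_mono, rule eventually_sequentiallyI)
    fix T assume T: "L + N \<le> T"
    let ?c = "h * (\<Sum>t=1..T. \<mu> (t - L) r) + p * (\<mu> (T - L) r - r * real (T - L) + mean * real T)"
    have "\<mu> N r * (real T - real (L + N)) \<le> (\<Sum>t=L+N+1..T. \<mu> N r)"
      using T by (simp add: of_nat_diff)
    also have "\<dots> \<le> (\<Sum>t=L+N+1..T. \<mu> (t - L) r)"
      by (intro sum_mono \<mu>_mono) auto
    also have "\<dots> \<le> (\<Sum>t=1..T. \<mu> (t - L) r)"
      by (rule sum_mono2) (auto simp: \<mu>_nonneg)
    finally have 1: "h * (\<mu> N r * (real T - real (L + N))) \<le> h * (\<Sum>t=1..T. \<mu> (t - L) r)"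
      using assms by (intro mult_left_mono) auto
    have "(mean - r) * real T \<le> \<mu> (T - L) r - r * real (T - L) + mean * real T"
      using \<mu>_nonneg[of "T - L" r] mult_left_mono[OF _ assms(1), of "real (T - L)" "real T"]
      by (simp add: algebra_simps)
    then have 2: "p * ((mean - r) * real T) \<le> p * (\<mu> (T - L) r - r * real (T - L) + mean * real T)"
      using assms by (intro mult_left_mono)
    have "lb T \<le> ?c / real T"
      unfolding lb_def mult.assoc using 1 2 by (intro divide_right_mono add_mono) auto
    moreover have "0 \<le> ?c"
    proof -
      have "0 \<le> p * ((mean - r) * real T)"
        using assms by simp
      also note 2
      finally show ?thesis
        using assms by (intro add_nonneg_nonneg[of "h * _"] mult_nonneg_nonneg[of h] sum_nonneg \<mu>_nonneg)
    qed
    ultimately show "ennreal (lb T) \<le>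
        (\<Sum>t=1..T. \<integral>\<^sup>+\<omega>. ennreal (period_cost d h p L (constant_order r) t \<omega>) \<partial>M) / of_nat T"
      unfolding sum_cost_constant_order[OF assms(1,3,4) L] using T L
      by (simp add: ennreal_of_nat_eq_real_of_nat divide_ennreal ennreal_leI)
  qed
  finally show ?thesis .
qed

lemma average_cost_constant_order_le:
  assumes "0 \<le> r" "r \<le> mean" "0 \<le> h" "0 \<le> p" and L: "1 \<le> L" and B: "\<And>N. \<mu> N r \<le> B"
  shows "average_cost M d h p L (constant_order r) \<le> ennreal (h * B + p * (mean - r))"
proof -
  \<comment> \<open>The constant \<open>p * (B + r * real L)\<close> covers the final stock and the
    \<open>L\<close> periods without delivery; it vanishes after division by
    \<open>T\<close>.\<close>
  define ub where "ub T = (h * B * real T + p * (B + r * real L + (mean - r) * real T)) / real T" for T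
  have "(\<lambda>T. h * B + p * (mean - r) + p * (B + r * real L) / real T)
      \<longlonglongrightarrow> h * B + p * (mean - r) + 0"
    by (intro tendsto_intros lim_const_over_n)
  moreover have "eventually (\<lambda>T. h * B + p * (mean - r) + p * (B + r * real L) / real T = ub T) sequentially"
    using eventually_gt_at_top[of 0]
    by eventually_elim (simp add: ub_def field_simps)
  ultimately have "ub \<longlonglongrightarrow> h * B + p * (mean - r)"
    by (simp add: tendsto_cong)
  then have lim: "limsup (\<lambda>T. ennreal (ub T)) = ennreal (h * B + p * (mean - r))"
    by (intro lim_imp_Limsup tendsto_ennrealI) auto
  have "average_cost M d h p L (constant_order r) \<le> limsup (\<lambda>T. ennreal (ub T))"
    unfolding average_cost_def
  proof (rule Limsup_mono, rule eventually_sequentiallyI)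
    fix T :: nat assume T: "1 \<le> T"
    let ?c = "h * (\<Sum>t=1..T. \<mu> (t - L) r) + p * (\<mu> (T - L) r - r * real (T - L) + mean * real T)"
    have "(\<Sum>t=1..T. \<mu> (t - L) r) \<le> B * real T"
      using sum_mono[of "{1..T}" "\<lambda>t. \<mu> (t - L) r" "\<lambda>_. B"] B by (simp add: mult.commute)
    then have 1: "h * (\<Sum>t=1..T. \<mu> (t - L) r) \<le> h * (B * real T)"
      using assms by (intro mult_left_mono) auto
    have "r * (real T - real L) \<le> r * real (T - L)"
      using assms by (intro mult_left_mono) auto
    then have "\<mu> (T - L) r - r * real (T - L) + mean * real T \<le> B + r * real L + (mean - r) * real T"
      using B[of "T - L"] by (simp add: algebra_simps)
    then have 2: "p * (\<mu> (T - L) r - r * real (T - L) + mean * real T)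
        \<le> p * (B + r * real L + (mean - r) * real T)"
      using assms by (intro mult_left_mono)
    have "?c / real T \<le> ub T"
      unfolding ub_def mult.assoc[of h] using 1 2 by (intro divide_right_mono add_mono) auto
    moreover have "0 \<le> ?c"
    proof -
      have "r * real (T - L) \<le> mean * real T"
        using assms by (intro mult_mono) auto
      then have "0 \<le> \<mu> (T - L) r - r * real (T - L) + mean * real T"
        using \<mu>_nonneg[of "T - L" r] by linarith
      then show ?thesis
        using assms by (intro add_nonneg_nonneg[of "h * _"] mult_nonneg_nonneg[of h]
          mult_nonneg_nonneg[of p] sum_nonneg \<mu>_nonneg)
    qed
    ultimately show "(\<Sum>t=1..T. \<integral>\<^sup>+\<omega>. ennreal (period_cost d h p L (constant_order r) t \<omega>) \<partial>M) / of_nat T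
        \<le> ennreal (ub T)"
      unfolding sum_cost_constant_order[OF assms(1,3,4) L] using T
      by (simp add: ennreal_of_nat_eq_real_of_nat divide_ennreal ennreal_leI)
  qed
  then show ?thesis
    unfolding lim .
qed

section \<open>Dependence on the order quantity\<close>

lemma hit_prob_eq: "hit_prob b k r = expectation (\<lambda>\<omega>. of_bool (positive b (k * r - demand_sum k \<omega>)))"
proof -
  let ?A = "{\<omega> \<in> space M. positive b (k * r - demand_sum k \<omega>)}"
  have "expectation (\<lambda>\<omega>. of_bool (positive b (k * r - demand_sum k \<omega>)) :: real) = expectation (indicator ?A)"
    by (intro Bochner_Integration.integral_cong refl) (auto simp: indicator_def)
  then show ?thesis
    by (simp add: hit_prob_def)
qed

lemma integrable_hit: "integrable M (\<lambda>\<omega>. of_bool (positive b (real k * r - demand_sum k \<omega>)) :: real)"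
  by (rule integrable_of_bool) measurable

lemma hit_prob_nonneg: "0 \<le> hit_prob b k r" and hit_prob_le_1: "hit_prob b k r \<le> 1"
  by (simp_all add: hit_prob_def)

text \<open>As a function of \<open>r\<close> the integrand is convex and piecewise linear with
  slope 0 or \<open>k\<close>. The strict event at the left end bounds the increase from below, the
  weak event at the right end from above.\<close>

lemma surplus_diff:
  assumes "r \<le> s"
  shows "k * (s - r) * hit_prob False k r \<le> surplus k s - surplus k r"
    and "surplus k s - surplus k r \<le> k * (s - r) * hit_prob True k s"
proof -
  have le: "real k * r \<le> real k * s"
    using assms by (intro mult_left_mono) auto
  have diff: "surplus k s - surplus k r = expectation (\<lambda>\<omega>.
      max 0 (real k * s - demand_sum k \<omega>) - max 0 (real k * r - demand_sum k \<omega>))"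
    unfolding surplus_def
    by (rule Bochner_Integration.integral_diff[symmetric]) (rule integrable_surplus)+
  have "k * (s - r) * hit_prob False k r
      = expectation (\<lambda>\<omega>. k * (s - r) * of_bool (positive False (k * r - demand_sum k \<omega>)))"
    unfolding hit_prob_eq by simp
  also have "\<dots> \<le> surplus k s - surplus k r"
    unfolding diff
    by (intro integral_mono Bochner_Integration.integrable_diff integrable_surplus
        integrable_mult_right integrable_hit) (use le in \<open>auto simp: positive_def max_def algebra_simps\<close>)
  finally show "k * (s - r) * hit_prob False k r \<le> surplus k s - surplus k r" .
  have "surplus k s - surplus k r
      \<le> expectation (\<lambda>\<omega>. k * (s - r) * of_bool (positive True (k * s - demand_sum k \<omega>)))"
    unfolding diff
    by (intro integral_mono Bochner_Integration.integrable_diff integrable_surplus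
        integrable_mult_right integrable_hit) (use le in \<open>auto simp: positive_def max_def algebra_simps\<close>)
  also have "\<dots> = k * (s - r) * hit_prob True k s"
    unfolding hit_prob_eq by simp
  finally show "surplus k s - surplus k r \<le> k * (s - r) * hit_prob True k s" .
qed

text \<open>The factor \<open>k\<close> cancels against Spitzer's \<open>1 / k\<close>: slopes of
  the expected maximum become expected maximizing indices.\<close>

lemma \<mu>_diff:
  assumes "r \<le> s"
  shows "(s - r) * (\<Sum>k=1..N. hit_prob False k r) \<le> \<mu> N s - \<mu> N r"
    and "\<mu> N s - \<mu> N r \<le> (s - r) * (\<Sum>k=1..N. hit_prob True k s)"
proof -
  have *: "\<mu> N s - \<mu> N r = (\<Sum>k=1..N. (surplus k s - surplus k r) / k)"
    by (simp add: \<mu>_eq_sum sum_subtractf diff_divide_distrib)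
  show "(s - r) * (\<Sum>k=1..N. hit_prob False k r) \<le> \<mu> N s - \<mu> N r"
    unfolding * sum_distrib_left
    by (intro sum_mono) (use surplus_diff(1)[OF assms] in \<open>auto simp: field_simps\<close>)
  show "\<mu> N s - \<mu> N r \<le> (s - r) * (\<Sum>k=1..N. hit_prob True k s)"
    unfolding * sum_distrib_left
    by (intro sum_mono) (use surplus_diff(2)[OF assms] in \<open>auto simp: field_simps\<close>)
qed

lemma continuous_on_\<mu>: "continuous_on UNIV (\<mu> N)"
proof -
  have le: "\<bar>\<mu> N s - \<mu> N r\<bar> \<le> real N * \<bar>s - r\<bar>" if "r \<le> s" for r s
  proof -
    have "(\<Sum>k=1..N. hit_prob True k s) \<le> real N"
      using sum_mono[of "{1..N}" "\<lambda>k. hit_prob True k s" "\<lambda>_. 1"] hit_prob_le_1 by simp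
    then have "(s - r) * (\<Sum>k=1..N. hit_prob True k s) \<le> (s - r) * real N"
      using that by (intro mult_left_mono) auto
    moreover have "0 \<le> (s - r) * (\<Sum>k=1..N. hit_prob False k r)"
      using that by (intro mult_nonneg_nonneg sum_nonneg hit_prob_nonneg) auto
    ultimately show ?thesis
      using \<mu>_diff[OF that, of N] that by (simp add: mult.commute)
  qed
  have "(real N)-lipschitz_on UNIV (\<mu> N)"
  proof (rule lipschitz_onI)
    show "dist (\<mu> N x) (\<mu> N y) \<le> real N * dist x y" for x y
      using le[of x y] le[of y x] by (cases "x \<le> y") (auto simp: dist_real_def abs_minus_commute)
  qed simp
  then show ?thesis
    by (rule lipschitz_on_continuous_on)
qed

text \<open>Weak probabilities are continuous from the right, strict ones from the left. From the
  permitted side each indicator is eventually constant, so dominated convergence applies.\<close>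

lemma hit_prob_tendsto:
  assumes "s \<longlonglongrightarrow> r" and "\<And>n. if b then r \<le> s n else s n \<le> r"
  shows "(\<lambda>n. hit_prob b k (s n)) \<longlonglongrightarrow> hit_prob b k r"
  unfolding hit_prob_eq
proof (rule integral_dominated_convergence[where w = "\<lambda>_. 1"])
  have lim: "(\<lambda>n. real k * s n) \<longlonglongrightarrow> real k * r"
    by (intro tendsto_intros assms)
  show "AE \<omega> in M. (\<lambda>n. of_bool (positive b (k * s n - demand_sum k \<omega>)) :: real)
      \<longlonglongrightarrow> of_bool (positive b (k * r - demand_sum k \<omega>))"
  proof (rule AE_I2, rule tendsto_eventually)
    fix \<omega>
    show "\<forall>\<^sub>F n in sequentially. of_bool (positive b (k * s n - demand_sum k \<omega>))
        = (of_bool (positive b (k * r - demand_sum k \<omega>)) :: real)"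
    proof (cases b)
      case True
      then have le: "k * r \<le> k * s n" for n
        using assms(2)[of n] by (auto intro: mult_left_mono)
      show ?thesis
      proof (cases "k * r < demand_sum k \<omega>")
        case less: True
        show ?thesis
          using order_tendstoD(2)[OF lim less] by eventually_elim (use less in \<open>auto simp: positive_def\<close>)
      next
        case False
        then show ?thesis
          using le order_trans[OF _ le] True by (intro always_eventually) (auto simp: positive_def not_less le_less)
      qed
    next
      case False
      then have le: "k * s n \<le> k * r" for n
        using assms(2)[of n] by (auto intro: mult_left_mono)
      show ?thesis
      proof (cases "demand_sum k \<omega> < k * r")
        case less: True
        show ?thesis
          using order_tendstoD(1)[OF lim less] by eventually_elim (use less in \<open>auto simp: positive_def\<close>)
      next
        case ge: False
        then have "\<not> demand_sum k \<omega> < k * s n" for n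
          using le[of n] by linarith
        then show ?thesis
          using ge False by (intro always_eventually) (auto simp: positive_def)
      qed
    qed
  qed
qed (use integrable_hit in auto)

section \<open>Divergence at the mean demand\<close>

text \<open>The positive part of a centered walk is a submartingale: an independent centered
  increment, added only where the walk is positive, leaves the expectation unchanged, and the true
  positive part dominates the result.\<close>

lemma surplus_mean_ge: "surplus 1 mean \<le> surplus (Suc k) mean"
proof (induction k)
  case (Suc k)
  let ?k = "Suc k"
  let ?U = "\<lambda>\<omega>. real ?k * mean - demand_sum ?k \<omega>"
  have eq: "demand_sum ?k \<omega> = (\<Sum>i\<in>{1..?k}. d i \<omega>)" for \<omega>
    unfolding demand_sum_def by (rule sum.reindex_bij_witness[of _ "\<lambda>i. i - 1" Suc]) auto
  have "indep_var borel (d (Suc ?k)) borel (\<lambda>\<omega>. \<Sum>i\<in>{1..?k}. d i \<omega>)"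
    by (intro indep_vars_sum indep_vars_subset[OF d_indep]) auto
  then have "indep_var borel ((\<lambda>x. mean - x) \<circ> d (Suc ?k)) borel
      ((\<lambda>u. of_bool (0 < real ?k * mean - u)) \<circ> (\<lambda>\<omega>. \<Sum>i\<in>{1..?k}. d i \<omega>))"
    by (rule indep_var_compose) measurable
  then have ind: "indep_var borel (\<lambda>\<omega>. mean - d (Suc ?k) \<omega>) borel (\<lambda>\<omega>. of_bool (0 < ?U \<omega>))"
    by (simp only: comp_def eq)
  have int: "integrable M (\<lambda>\<omega>. mean - d (Suc ?k) \<omega>)" "integrable M (\<lambda>\<omega>. of_bool (0 < ?U \<omega>) :: real)"
    by (simp, intro integrable_of_bool, measurable)
  have prod: "integrable M (\<lambda>\<omega>. (mean - d (Suc ?k) \<omega>) * of_bool (0 < ?U \<omega>))"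
    "expectation (\<lambda>\<omega>. (mean - d (Suc ?k) \<omega>) * of_bool (0 < ?U \<omega>)) = 0"
    using indep_var_integrable[OF ind int] indep_var_lebesgue_integral[OF ind int]
      expectation_d[of "Suc ?k"] by (simp_all add: prob_space)
  have "surplus ?k mean = expectation (\<lambda>\<omega>. max 0 (?U \<omega>) + (mean - d (Suc ?k) \<omega>) * of_bool (0 < ?U \<omega>))"
    using prod integrable_surplus[of ?k mean] unfolding surplus_def
    by (subst Bochner_Integration.integral_add) auto
  also have "\<dots> \<le> surplus (Suc ?k) mean"
    unfolding surplus_def
  proof (intro integral_mono Bochner_Integration.integrable_add prod integrable_surplus)
    fix \<omega>
    have "real (Suc ?k) * mean - demand_sum (Suc ?k) \<omega> = ?U \<omega> + (mean - d (Suc ?k) \<omega>)"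
      by (simp add: demand_sum_def algebra_simps)
    then show "max 0 (?U \<omega>) + (mean - d (Suc ?k) \<omega>) * of_bool (0 < ?U \<omega>)
        \<le> max 0 (real (Suc ?k) * mean - demand_sum (Suc ?k) \<omega>)"
      by (auto simp: max_def)
  qed
  finally show ?case
    using Suc.IH by simp
qed simp

lemma surplus_1_mean_pos:
  assumes "\<not> (AE \<omega> in M. D \<omega> = mean)"
  shows "0 < surplus 1 mean"
proof (rule ccontr)
  assume "\<not> 0 < surplus 1 mean"
  then have 0: "surplus 1 mean = 0"
    using surplus_nonneg[of 1 mean] by simp
  have "surplus 1 mean = expectation (\<lambda>\<omega>. max 0 (mean - D \<omega>))"
    unfolding surplus_def by (subst integral_d[of 1 "\<lambda>x. max 0 (mean - x)", symmetric]) (simp_all add: demand_sum_def)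
  moreover have int: "integrable M (\<lambda>\<omega>. max 0 (mean - D \<omega>))"
    using D_integrable by simp
  ultimately have "AE \<omega> in M. max 0 (mean - D \<omega>) = 0"
    using 0 integral_nonneg_eq_0_iff_AE[OF int] by simp
  then have ge: "AE \<omega> in M. 0 \<le> D \<omega> - mean"
    by eventually_elim (simp add: max_def split: if_splits)
  have "expectation (\<lambda>\<omega>. D \<omega> - mean) = 0"
    using D_integrable by (simp add: mean_def prob_space)
  then have "AE \<omega> in M. D \<omega> - mean = 0"
    using integral_nonneg_eq_0_iff_AE[OF _ ge] D_integrable by simp
  with assms show False
    by simp
qed

text \<open>Every summand in Spitzer's identity is at least \<open>c / k\<close> with
  \<open>c > 0\<close>, so the harmonic series diverges. This matches the convention of cost
  \<open>\<infinity>\<close> at the mean.\<close>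

lemma \<mu>_mean_unbounded:
  assumes "\<not> (AE \<omega> in M. D \<omega> = mean)"
  shows "\<exists>N. B < \<mu> N mean"
proof -
  define c where "c = surplus 1 mean"
  have c: "0 < c"
    unfolding c_def by (rule surplus_1_mean_pos[OF assms])
  have "filterlim (harm :: nat \<Rightarrow> real) at_top sequentially"
    by (rule harm_at_top)
  then obtain N where "B / c < harm N"
    unfolding filterlim_at_top_dense eventually_sequentially by blast
  then have "B < c * harm N"
    using c by (simp add: field_simps)
  also have "\<dots> = (\<Sum>k=1..N. c / k)"
    by (simp add: harm_def sum_distrib_left field_simps)
  also have "\<dots> \<le> \<mu> N mean"
    unfolding \<mu>_eq_sum
  proof (intro sum_mono divide_right_mono)
    fix k assume "k \<in> {1..N}"
    then show "c \<le> surplus k mean"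
      using surplus_mean_ge[of "k - 1"] by (simp add: c_def)
  qed auto
  finally show ?thesis ..
qed

lemma mean_pos:
  assumes "\<not> (AE \<omega> in M. D \<omega> = mean)"
  shows "0 < mean"
proof (rule ccontr)
  assume "\<not> 0 < mean"
  then have "mean = 0"
    using mean_nonneg by simp
  moreover from this have "AE \<omega> in M. D \<omega> = 0"
    using integral_nonneg_eq_0_iff_AE[OF D_integrable D_nonneg] by (simp add: mean_def)
  ultimately show False
    using assms by simp
qed

lemma \<mu>_at_0: "\<mu> N 0 = 0"
proof -
  have "surplus k 0 = 0" for k
  proof -
    have "AE \<omega> in M. max 0 (real k * 0 - demand_sum k \<omega>) = 0"
      using AE_all_d_nonneg
    proof (rule AE_mp, intro AE_I2 impI)
      fix \<omega> assume "\<forall>t\<ge>1. 0 \<le> d t \<omega>"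
      then have "0 \<le> demand_sum k \<omega>"
        unfolding demand_sum_def by (intro sum_nonneg) simp
      then show "max 0 (real k * 0 - demand_sum k \<omega>) = 0"
        by simp
    qed
    then show ?thesis
      unfolding surplus_def by (rule integral_eq_zero_AE)
  qed
  then show ?thesis
    by (simp add: \<mu>_eq_sum)
qed

section \<open>The optimal constant order\<close>

text \<open>Turns a statement about an extended-real limsup into countably many real inequalities
  that are continuous in \<open>r\<close>. Sublevel sets of the cost are therefore closed.\<close>

lemma constant_order_cost_le_iff:
  assumes "0 \<le> r" "r \<le> mean" "0 < h" "0 \<le> p" "1 \<le> L" "0 \<le> w"
    and nondeg: "\<not> (AE \<omega> in M. D \<omega> = mean)"
  shows "constant_order_cost M d h p L mean r \<le> ennreal w \<longleftrightarrow> (\<forall>N. h * \<mu> N r + p * (mean - r) \<le> w)"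
proof (cases "r < mean")
  case True
  show ?thesis
  proof
    assume le: "constant_order_cost M d h p L mean r \<le> ennreal w"
    show "\<forall>N. h * \<mu> N r + p * (mean - r) \<le> w"
    proof
      fix N
      have "ennreal (h * \<mu> N r + p * (mean - r)) \<le> average_cost M d h p L (constant_order r)"
        using assms by (intro average_cost_constant_order_ge) auto
      also have "\<dots> \<le> ennreal w"
        using le True by (simp add: constant_order_cost_def)
      finally have "ennreal (h * \<mu> N r + p * (mean - r)) \<le> ennreal w" .
      then show "h * \<mu> N r + p * (mean - r) \<le> w"
        using assms(6) by (simp add: ennreal_le_iff)
    qed
  next
    assume le: "\<forall>N. h * \<mu> N r + p * (mean - r) \<le> w"
    \<comment> \<open>The bound on all \<open>\<mu> N r\<close> is obtained by solving the
      hypothesis for \<open>\<mu> N r\<close>.\<close>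
    have "average_cost M d h p L (constant_order r) \<le> ennreal (h * ((w - p * (mean - r)) / h) + p * (mean - r))"
      using assms le
      by (intro average_cost_constant_order_le) (auto simp: field_simps)
    then show "constant_order_cost M d h p L mean r \<le> ennreal w"
      using assms True by (simp add: constant_order_cost_def)
  qed
next
  case False
  then have r: "r = mean"
    using assms by simp
  obtain N where "w / h < \<mu> N mean"
    using \<mu>_mean_unbounded[OF nondeg] by blast
  then have "\<not> h * \<mu> N r + p * (mean - r) \<le> w"
    using assms by (simp add: r field_simps)
  then show ?thesis
    using r by (auto simp: constant_order_cost_def top_unique)
qed

text \<open>The cost is a supremum of continuous functions, hence lower semicontinuous, and
  \<open>{0..mean}\<close> is compact. The minimizers form a nonempty closed set, which contains its
  infimum.\<close>

lemma r_inf_minimizer: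
  assumes "0 < h" "0 \<le> p" "1 \<le> L" and nondeg: "\<not> (AE \<omega> in M. D \<omega> = mean)"
  defines "r \<equiv> r_inf M d h p L mean"
  shows "0 \<le> r" and "r < mean"
    and "\<And>s. 0 \<le> s \<Longrightarrow> s \<le> mean \<Longrightarrow>
      constant_order_cost M d h p L mean r \<le> constant_order_cost M d h p L mean s"
proof -
  let ?K = "constant_order_cost M d h p L mean"
  define v where "v = (INF s\<in>{0..mean}. ?K s)"
  note le_iff = constant_order_cost_le_iff[OF _ _ assms(1-3) _ nondeg]
  have m: "0 < mean"
    by (rule mean_pos[OF nondeg])
  have K0: "?K 0 \<le> ennreal (p * mean)"
    using m assms by (subst le_iff) (auto simp: \<mu>_at_0)
  have "v \<le> ?K 0"
    unfolding v_def using m by (intro INF_lower) auto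
  then have "v < \<infinity>"
    using K0 by (simp add: le_less_trans)
  then obtain w where w: "0 \<le> w" "v = ennreal w"
    by (cases v) auto
  let ?S = "{0..mean} \<inter> (\<Inter>N. {r. h * \<mu> N r + p * (mean - r) \<le> w})"
  have S_iff: "s \<in> ?S \<longleftrightarrow> s \<in> {0..mean} \<and> ?K s \<le> v" for s
    using le_iff[of s w] w by auto
  have S_eq: "{r \<in> {0..mean}. \<forall>s\<in>{0..mean}. ?K r \<le> ?K s} = ?S"
    unfolding set_eq_iff S_iff by (auto simp: v_def le_INF_iff)
  have closed: "closed {r. h * \<mu> N r + p * (mean - r) \<le> w}" for N
    by (intro closed_Collect_le continuous_intros continuous_on_\<mu>)
  have "?S \<noteq> {}"
  proof -
    \<comment> \<open>A minimizing sequence; a cluster point inherits the inequality for each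
      \<open>N\<close> separately, by continuity of \<open>\<mu> N\<close>.\<close>
    have "\<exists>s\<in>{0..mean}. ?K s < ennreal (w + 1 / real (Suc n))" for n
    proof -
      have "v < ennreal (w + 1 / real (Suc n))"
        unfolding w(2) using w(1) by (subst ennreal_less_iff) auto
      then show ?thesis
        unfolding v_def by (simp add: INF_less_iff)
    qed
    then obtain s where s: "\<And>n. s n \<in> {0..mean}" "\<And>n. ?K (s n) < ennreal (w + 1 / real (Suc n))"
      by metis
    obtain l \<sigma> where l: "l \<in> {0..mean}" and \<sigma>: "strict_mono \<sigma>" and lim: "(s \<circ> \<sigma>) \<longlonglongrightarrow> l"
      using compact_Icc[of 0 mean] s(1) unfolding compact_def by blast
    have "h * \<mu> N l + p * (mean - l) \<le> w" for N
    proof (rule LIMSEQ_le)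
      have "isCont (\<mu> N) l"
        using continuous_on_\<mu> by (simp add: continuous_on_eq_continuous_at)
      then have "(\<lambda>n. \<mu> N ((s \<circ> \<sigma>) n)) \<longlonglongrightarrow> \<mu> N l"
        using lim by (rule isCont_tendsto_compose)
      then show "(\<lambda>n. h * \<mu> N ((s \<circ> \<sigma>) n) + p * (mean - (s \<circ> \<sigma>) n)) \<longlonglongrightarrow> h * \<mu> N l + p * (mean - l)"
        using lim by (intro tendsto_intros)
      have "(\<lambda>n. 1 / real (Suc n)) \<longlonglongrightarrow> 0"
        using LIMSEQ_inverse_real_of_nat by (simp add: inverse_eq_divide)
      then have "((\<lambda>n. 1 / real (Suc n)) \<circ> \<sigma>) \<longlonglongrightarrow> 0"
        using \<sigma> by (rule LIMSEQ_subseq_LIMSEQ)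
      then have "(\<lambda>n. w + ((\<lambda>n. 1 / real (Suc n)) \<circ> \<sigma>) n) \<longlonglongrightarrow> w + 0"
        by (intro tendsto_intros)
      then show "(\<lambda>n. w + 1 / real (Suc (\<sigma> n))) \<longlonglongrightarrow> w"
        by (simp add: comp_def)
      have "h * \<mu> N (s n) + p * (mean - s n) \<le> w + 1 / real (Suc n)" for n
        using le_iff[of "s n" "w + 1 / real (Suc n)"] less_imp_le[OF s(2)[of n]] s(1)[of n] w(1) by auto
      then show "\<exists>N'. \<forall>n\<ge>N'. h * \<mu> N ((s \<circ> \<sigma>) n) + p * (mean - (s \<circ> \<sigma>) n) \<le> w + 1 / real (Suc (\<sigma> n))"
        by simp
    qed
    then show ?thesis
      using l by auto
  qed
  moreover have "closed ?S"
    using closed by (intro closed_Int closed_INT) auto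
  moreover have "bdd_below ?S"
    by (rule bdd_below_mono[of "{0..mean}"]) auto
  ultimately have "Inf ?S \<in> ?S"
    by (intro closed_contains_Inf)
  then have r: "r \<in> {0..mean}" "?K r \<le> v"
    unfolding r_def r_inf_def S_eq using S_iff by blast+
  then show "0 \<le> r"
    by simp
  show "r < mean"
    using r \<open>v < \<infinity>\<close> by (auto simp: constant_order_cost_def split: if_splits)
  show "?K r \<le> ?K s" if "0 \<le> s" "s \<le> mean" for s
  proof -
    note r(2)
    also have "v \<le> ?K s"
      unfolding v_def using that by (intro INF_lower) auto
    finally show ?thesis .
  qed
qed

section \<open>Exponential bounds\<close>

lemma integrable_exp: "0 \<le> \<theta> \<Longrightarrow> integrable M (\<lambda>\<omega>. exp (- \<theta> * D \<omega>))"
  by (rule integrable_const_bound[where B = 1]) (use D_nonneg in \<open>auto intro!: mult_nonneg_nonneg\<close>)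

lemma phi_nonneg: "0 \<le> phi M D r \<theta>"
  unfolding phi_def by (intro mult_nonneg_nonneg Bochner_Integration.integral_nonneg) auto

lemma phi_0: "phi M D r 0 = 1"
  by (simp add: phi_def prob_space)

lemma phi_shift: "phi M D s \<theta> = exp (\<theta> * (s - r)) * phi M D r \<theta>"
  by (simp add: phi_def exp_add[symmetric] algebra_simps)

lemma exp_walk:
  assumes "0 \<le> \<theta>"
  shows "integrable M (\<lambda>\<omega>. exp (\<theta> * (real k * r - demand_sum k \<omega>)))"
    and "expectation (\<lambda>\<omega>. exp (\<theta> * (real k * r - demand_sum k \<omega>))) = phi M D r \<theta> ^ k"
proof -
  have eq: "exp (\<theta> * (real k * r - demand_sum k \<omega>)) = (\<Prod>i<k. exp (\<theta> * (r - d (Suc i) \<omega>)))" for \<omega>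
    unfolding sum_increments[symmetric] sum_distrib_left by (rule exp_sum) simp
  have "indep_vars (\<lambda>_. borel) (\<lambda>i. d (Suc i)) UNIV"
    by (rule indep_vars_reindex) auto
  then have "indep_vars (\<lambda>_. borel) (\<lambda>i. d (Suc i)) {..<k}"
    by (rule indep_vars_subset) simp
  then have ind: "indep_vars (\<lambda>_. borel) (\<lambda>i \<omega>. exp (\<theta> * (r - d (Suc i) \<omega>))) {..<k}"
    by (rule indep_vars_compose2[where Y = "\<lambda>_ x. exp (\<theta> * (r - x))"]) measurable
  have "exp (\<theta> * (r - x)) = exp (\<theta> * r) * exp (- \<theta> * x)" for x
    by (simp add: exp_add[symmetric] algebra_simps)
  then have int: "integrable M (\<lambda>\<omega>. exp (\<theta> * (r - d (Suc i) \<omega>)))"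
    and E: "expectation (\<lambda>\<omega>. exp (\<theta> * (r - d (Suc i) \<omega>))) = phi M D r \<theta>" for i
    using integrable_exp[OF assms]
    by (simp_all add: integrable_d_iff[of "Suc i" "\<lambda>x. exp (- (\<theta> * x))"]
        integral_d[of "Suc i" "\<lambda>x. exp (- (\<theta> * x))"] phi_def)
  show "integrable M (\<lambda>\<omega>. exp (\<theta> * (real k * r - demand_sum k \<omega>)))"
    unfolding eq by (rule indep_vars_integrable[OF _ ind int]) simp
  show "expectation (\<lambda>\<omega>. exp (\<theta> * (real k * r - demand_sum k \<omega>))) = phi M D r \<theta> ^ k"
    unfolding eq by (subst indep_vars_lebesgue_integral[OF _ ind int]) (simp_all add: E)
qed

lemma hit_prob_le_phi: "0 \<le> \<theta> \<Longrightarrow> hit_prob b k r \<le> phi M D r \<theta> ^ k"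
  unfolding hit_prob_eq exp_walk(2)[symmetric]
  by (intro integral_mono integrable_hit exp_walk(1)) (auto simp: positive_def)

text \<open>From \<open>exp y \<ge> 1 + y\<close> at \<open>y = \<theta> * x - 1\<close> one gets
  \<open>x \<le> exp (\<theta> * x) / (e * \<theta>)\<close>.\<close>

lemma surplus_le_phi:
  assumes "0 < \<theta>"
  shows "surplus k r \<le> phi M D r \<theta> ^ k / (exp 1 * \<theta>)"
proof -
  have "max 0 x \<le> exp (\<theta> * x) / (exp 1 * \<theta>)" for x
  proof -
    have "\<theta> * x \<le> exp (\<theta> * x - 1)"
      using exp_ge_add_one_self[of "\<theta> * x - 1"] by simp
    then have "x \<le> exp (\<theta> * x) / (exp 1 * \<theta>)"
      using assms by (simp add: exp_diff field_simps)
    then show ?thesis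
      using assms by simp
  qed
  then have "surplus k r \<le> expectation (\<lambda>\<omega>. exp (\<theta> * (real k * r - demand_sum k \<omega>)) / (exp 1 * \<theta>))"
    unfolding surplus_def using assms
    by (intro integral_mono integrable_surplus integrable_divide exp_walk(1)) auto
  also have "\<dots> = phi M D r \<theta> ^ k / (exp 1 * \<theta>)"
    using exp_walk(2)[of \<theta> k r] assms by simp
  finally show ?thesis .
qed

lemma bdd_below_phi: "bdd_below (phi M D r ` {0..})"
  by (rule bdd_belowI[of _ 0]) (auto simp: phi_nonneg)

lemma gamma_rate_le: "0 \<le> \<theta> \<Longrightarrow> gamma_rate M D r \<le> phi M D r \<theta>"
  unfolding gamma_rate_def by (rule cINF_lower[OF bdd_below_phi]) simp

lemma gamma_rate_nonneg: "0 \<le> gamma_rate M D r"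
  unfolding gamma_rate_def by (rule cINF_greatest) (auto simp: phi_nonneg)

lemma gamma_rate_le_1: "gamma_rate M D r \<le> 1"
  using gamma_rate_le[of 0 r] by (simp add: phi_0)

lemma gamma_rate_less:
  assumes "gamma_rate M D r < x"
  shows "\<exists>\<theta>\<ge>0. phi M D r \<theta> < x"
  using assms unfolding gamma_rate_def by (subst (asm) cINF_less_iff[OF _ bdd_below_phi]) auto

lemma phi_minimizer:
  assumes "\<theta> \<in> phi_minimizers M D r"
  shows "0 \<le> \<theta>" "phi M D r \<theta> = gamma_rate M D r"
proof -
  show "0 \<le> \<theta>"
    using assms by (simp add: phi_minimizers_def)
  then show "phi M D r \<theta> = gamma_rate M D r"
    using assms gamma_rate_le[of \<theta> r] unfolding gamma_rate_def phi_minimizers_def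
    by (intro antisym cINF_greatest) auto
qed

lemma continuous_on_phi: "continuous_on {0..} (phi M D r)"
  unfolding continuous_on_sequentially
proof (intro allI ballI impI)
  fix \<theta> :: "nat \<Rightarrow> real" and l
  assume "l \<in> {0..}" and "(\<forall>n. \<theta> n \<in> {0..}) \<and> \<theta> \<longlonglongrightarrow> l"
  then have \<theta>: "\<And>n. 0 \<le> \<theta> n" and lim: "\<theta> \<longlonglongrightarrow> l"
    by auto
  have "(\<lambda>n. expectation (\<lambda>\<omega>. exp (- \<theta> n * D \<omega>))) \<longlonglongrightarrow> expectation (\<lambda>\<omega>. exp (- l * D \<omega>))"
  proof (rule integral_dominated_convergence[where w = "\<lambda>_. 1"])
    show "AE \<omega> in M. (\<lambda>n. exp (- \<theta> n * D \<omega>)) \<longlonglongrightarrow> exp (- l * D \<omega>)"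
      by (intro AE_I2 tendsto_intros lim)
    show "AE \<omega> in M. norm (exp (- \<theta> n * D \<omega>)) \<le> 1" for n
      using D_nonneg by eventually_elim (simp add: \<theta>)
  qed simp_all
  then show "(phi M D r \<circ> \<theta>) \<longlonglongrightarrow> phi M D r l"
    unfolding phi_def comp_def by (intro tendsto_intros lim)
qed

text \<open>If \<open>phi\<close> exceeded its value 1 at 0 everywhere beyond \<open>B\<close>, its
  minimum over a compact interval would be a global one.\<close>

lemma phi_le_1_unbounded:
  assumes "phi_minimizers M D r = {}"
  shows "\<exists>\<theta>>B. phi M D r \<theta> \<le> 1"
proof (rule ccontr)
  assume "\<not> ?thesis"
  then have gt: "1 < phi M D r \<theta>" if "B < \<theta>" for \<theta>
    using that by force
  \<comment> \<open>\<open>B\<close> may be negative, but the interval has to contain 0.\<close>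
  define C where "C = max B 0"
  have "continuous_on {0..C} (phi M D r)"
    by (rule continuous_on_subset[OF continuous_on_phi]) auto
  then obtain \<theta> where \<theta>: "\<theta> \<in> {0..C}" "\<And>\<eta>. \<eta> \<in> {0..C} \<Longrightarrow> phi M D r \<theta> \<le> phi M D r \<eta>"
    using continuous_attains_inf[of "{0..C}" "phi M D r"] by (auto simp: C_def)
  have "phi M D r \<theta> \<le> phi M D r \<eta>" if "0 \<le> \<eta>" for \<eta>
  proof (cases "\<eta> \<le> C")
    case False
    then have "1 < phi M D r \<eta>"
      by (intro gt) (auto simp: C_def)
    moreover have "phi M D r \<theta> \<le> 1"
      using \<theta>(2)[of 0] by (simp add: phi_0 C_def)
    ultimately show ?thesis
      by simp
  qed (use that \<theta> in auto)
  then have "\<theta> \<in> phi_minimizers M D r"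
    using \<theta> by (simp add: phi_minimizers_def)
  with assms show False
    by simp
qed

lemma \<mu>_tail_le:
  assumes "0 < \<theta>" "phi M D r \<theta> < 1"
  shows "\<mu> N r \<le> \<mu> L r + phi M D r \<theta> ^ Suc L / (1 - phi M D r \<theta>) / (exp 1 * \<theta> * real (Suc L))"
proof (cases "L \<le> N")
  case True
  let ?x = "phi M D r \<theta>"
  have "\<mu> N r = \<mu> L r + (\<Sum>k=Suc L..N. surplus k r / k)"
    unfolding \<mu>_eq_sum using sum_split[OF True] .
  also have "(\<Sum>k=Suc L..N. surplus k r / k) \<le> (\<Sum>k=Suc L..N. ?x ^ k / (exp 1 * \<theta> * real (Suc L)))"
  proof (rule sum_mono)
    fix k assume k: "k \<in> {Suc L..N}"
    have "surplus k r / k \<le> (?x ^ k / (exp 1 * \<theta>)) / real (Suc L)"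
      using surplus_le_phi[OF assms(1), of k r] surplus_nonneg[of k r] k
      by (intro frac_le) auto
    then show "surplus k r / k \<le> ?x ^ k / (exp 1 * \<theta> * real (Suc L))"
      by simp
  qed
  also have "\<dots> = (\<Sum>k=Suc L..N. ?x ^ k) / (exp 1 * \<theta> * real (Suc L))"
    by (rule sum_divide_distrib[symmetric])
  also have "\<dots> \<le> ?x ^ Suc L / (1 - ?x) / (exp 1 * \<theta> * real (Suc L))"
    using assms phi_nonneg by (intro divide_right_mono sum_power_tail_le) auto
  finally show ?thesis
    by simp
next
  case False
  then have "\<mu> N r \<le> \<mu> L r"
    by (intro \<mu>_mono) auto
  moreover have "0 \<le> phi M D r \<theta> ^ Suc L / (1 - phi M D r \<theta>) / (exp 1 * \<theta> * real (Suc L))"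
    using assms phi_nonneg by (intro divide_nonneg_nonneg) auto
  ultimately show ?thesis
    by simp
qed

text \<open>Along arbitrarily large \<open>\<theta>\<close> with \<open>phi \<le> 1\<close>, each
  surplus is at most \<open>1 / (e * \<theta>)\<close> and so vanishes. This agrees with the
  convention \<open>1 / \<infinity> = 0\<close>.\<close>

lemma \<mu>_tail_unattained:
  assumes "phi_minimizers M D r = {}"
  shows "\<mu> N r \<le> \<mu> L r"
proof -
  have "surplus k r = 0" for k
  proof (rule ccontr)
    assume "surplus k r \<noteq> 0"
    then have pos: "0 < surplus k r"
      using surplus_nonneg[of k r] by simp
    obtain \<theta> where \<theta>: "1 / (exp 1 * surplus k r) < \<theta>" "phi M D r \<theta> \<le> 1"
      using phi_le_1_unbounded[OF assms] by blast
    have "0 < 1 / (exp 1 * surplus k r)"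
      using pos by simp
    then have \<theta>_pos: "0 < \<theta>"
      using \<theta>(1) by linarith
    have "phi M D r \<theta> ^ k \<le> 1"
      using \<theta>(2) phi_nonneg by (simp add: power_le_one)
    then have "phi M D r \<theta> ^ k / (exp 1 * \<theta>) \<le> 1 / (exp 1 * \<theta>)"
      using \<theta>_pos by (intro divide_right_mono) auto
    then have "surplus k r \<le> 1 / (exp 1 * \<theta>)"
      using surplus_le_phi[OF \<theta>_pos, of k r] by linarith
    then show False
      using \<theta>(1) \<theta>_pos pos by (simp add: field_simps)
  qed
  then show ?thesis
    by (simp add: \<mu>_eq_sum)
qed

section \<open>Optimality conditions\<close>

lemma minimizer_comparison:
  assumes "0 < h" "0 \<le> p" "1 \<le> L" "0 \<le> r" "r < mean" "0 \<le> s" "s < mean"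
    and min: "constant_order_cost M d h p L mean r \<le> constant_order_cost M d h p L mean s"
    and B: "\<And>N. \<mu> N s \<le> B"
  shows "h * \<mu> N r + p * (mean - r) \<le> h * B + p * (mean - s)"
proof -
  have "ennreal (h * \<mu> N r + p * (mean - r)) \<le> average_cost M d h p L (constant_order r)"
    using assms by (intro average_cost_constant_order_ge) auto
  also have "\<dots> \<le> average_cost M d h p L (constant_order s)"
    using min assms by (simp add: constant_order_cost_def)
  also have "\<dots> \<le> ennreal (h * B + p * (mean - s))"
    using assms by (intro average_cost_constant_order_le) auto
  finally show ?thesis
    using assms B[of 0] by (subst (asm) ennreal_le_iff) auto
qed

context
  fixes h p :: real and L :: nat and r F :: real
  assumes hp: "0 < h" "0 \<le> p" and L: "1 \<le> L" and r: "0 \<le> r" "r < mean"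
    and min: "\<And>s. 0 \<le> s \<Longrightarrow> s \<le> mean \<Longrightarrow>
      constant_order_cost M d h p L mean r \<le> constant_order_cost M d h p L mean s"
  defines "F \<equiv> SUP N. \<mu> N r"
begin

lemma bdd_above_\<mu>: "bdd_above (range (\<lambda>N. \<mu> N r))"
proof (rule bdd_aboveI)
  fix x assume "x \<in> range (\<lambda>N. \<mu> N r)"
  then obtain N where "x = \<mu> N r"
    by auto
  \<comment> \<open>Ordering nothing costs \<open>p * mean\<close>, which caps the cost of the
    minimizer.\<close>
  moreover have "h * \<mu> N r + p * (mean - r) \<le> h * 0 + p * (mean - 0)"
    by (rule minimizer_comparison[OF hp L r]) (use r in \<open>auto simp: \<mu>_at_0 intro: min\<close>)
  ultimately show "x \<le> p * r / h"
    using hp by (simp add: field_simps)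
qed

lemma \<mu>_le_F: "\<mu> N r \<le> F"
  unfolding F_def by (rule cSUP_upper[OF _ bdd_above_\<mu>]) simp

lemma F_le: "(\<And>N. \<mu> N r \<le> B) \<Longrightarrow> F \<le> B"
  unfolding F_def by (rule cSUP_least) auto

lemma F_comparison:
  assumes "0 \<le> s" "s < mean" "\<And>N. \<mu> N s \<le> B"
  shows "h * F + p * (mean - r) \<le> h * B + p * (mean - s)"
proof -
  have "\<mu> N r \<le> (h * B + p * (mean - s) - p * (mean - r)) / h" for N
    using minimizer_comparison[OF hp L r assms(1,2) min assms(3), of N] assms hp by (simp add: field_simps)
  then have "F \<le> (h * B + p * (mean - s) - p * (mean - r)) / h"
    by (rule F_le)
  then show ?thesis
    using hp by (simp add: field_simps)
qed

lemma average_cost_r_le: "average_cost M d h p L (constant_order r) \<le> ennreal (h * F + p * (mean - r))"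
  using hp L r \<mu>_le_F by (intro average_cost_constant_order_le) auto

text \<open>Optimality against smaller orders \<open>s\<close>: the slope below \<open>r\<close> is
  at least the strict sum at \<open>s\<close>, and \<open>s\<close> increases to \<open>r\<close>.
  At \<open>r = 0\<close> there is no smaller order, but nonnegative demands make the strict
  probabilities vanish.\<close>

lemma sum_hit_prob_strict_le: "h * (\<Sum>k=1..L. hit_prob False k r) \<le> p"
proof (cases "r = 0")
  case True
  have "hit_prob False k 0 = 0" for k
  proof -
    have "AE \<omega> in M. of_bool (positive False (real k * 0 - demand_sum k \<omega>)) = (0 :: real)"
      using AE_all_d_nonneg
    proof (rule AE_mp, intro AE_I2 impI)
      fix \<omega> assume "\<forall>t\<ge>1. 0 \<le> d t \<omega>"
      then have "0 \<le> demand_sum k \<omega>"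
        unfolding demand_sum_def by (intro sum_nonneg) simp
      then show "of_bool (positive False (real k * 0 - demand_sum k \<omega>)) = (0 :: real)"
        by (simp add: positive_def)
    qed
    then show ?thesis
      unfolding hit_prob_eq by (rule integral_eq_zero_AE)
  qed
  then show ?thesis
    using True hp by simp
next
  case False
  then have r_pos: "0 < r"
    using r by simp
  have step: "h * (\<Sum>k=1..L. hit_prob False k s) \<le> p" if s: "0 \<le> s" "s < r" for s
  proof -
    let ?H = "\<lambda>N. \<Sum>k=1..N. hit_prob False k s"
    \<comment> \<open>The increase from \<open>s\<close> to \<open>r\<close> is estimated at the
      horizon \<open>K\<close>, which exceeds both \<open>N\<close> and \<open>L\<close>.\<close>
    have "\<mu> N s \<le> F - (r - s) * ?H L" for N
    proof -
      define K where "K = max N L"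
      have "(r - s) * ?H L \<le> (r - s) * ?H K"
        using s by (intro mult_left_mono sum_mono2) (auto simp: K_def hit_prob_nonneg)
      moreover have "(r - s) * ?H K \<le> \<mu> K r - \<mu> K s"
        using s by (intro \<mu>_diff) auto
      moreover have "\<mu> N s \<le> \<mu> K s"
        by (rule \<mu>_mono) (simp add: K_def)
      ultimately show ?thesis
        using \<mu>_le_F[of K] by linarith
    qed
    then have "h * F + p * (mean - r) \<le> h * (F - (r - s) * ?H L) + p * (mean - s)"
      using s r by (intro F_comparison) auto
    then have "(r - s) * (h * ?H L) \<le> (r - s) * p"
      by (simp add: algebra_simps)
    then show ?thesis
      using s by simp
  qed
  define s where "s n = r - r / real (Suc n)" for n
  have "s \<longlonglongrightarrow> r - 0"
    unfolding s_def[abs_def]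
    by (intro tendsto_intros LIMSEQ_Suc[OF lim_const_over_n])
  then have s: "s \<longlonglongrightarrow> r"
    by simp
  have "s n \<le> r" for n
    using r_pos by (simp add: s_def)
  then have lim: "(\<lambda>n. h * (\<Sum>k=1..L. hit_prob False k (s n))) \<longlonglongrightarrow> h * (\<Sum>k=1..L. hit_prob False k r)"
    by (intro tendsto_mult tendsto_const tendsto_sum hit_prob_tendsto[OF s]) simp
  show ?thesis
  proof (rule LIMSEQ_le_const2[OF lim], intro exI allI impI step)
    fix n
    have "r / real (Suc n) \<le> r / 1"
      using r_pos by (intro divide_left_mono) auto
    then show "0 \<le> s n"
      by (simp add: s_def)
    show "s n < r"
      using r_pos by (simp add: s_def)
  qed
qed

text \<open>Optimality against larger orders \<open>s\<close>: the slope above \<open>r\<close> is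
  at most the weak sum at \<open>s\<close> over all horizons, whose part beyond \<open>L\<close> is
  a geometric tail by Chernoff's bound.\<close>

lemma le_sum_hit_prob:
  assumes "gamma_rate M D r < 1"
  shows "p \<le> h * ((\<Sum>k=1..L. hit_prob True k r) + gamma_rate M D r ^ Suc L / (1 - gamma_rate M D r))"
proof -
  let ?g = "gamma_rate M D r"
  let ?H = "\<lambda>s. \<Sum>k=1..L. hit_prob True k s"
  \<comment> \<open>The ratio \<open>x\<close> is slightly larger than \<open>\<gamma>\<close>,
    because the infimum need not be attained and because Chernoff's bound is used at
    \<open>s\<close> instead of \<open>r\<close>. The limit in \<open>s\<close> precedes the limit
    in \<open>x\<close>.\<close>
  have bound: "p \<le> h * (?H r + x ^ Suc L / (1 - x))" if x: "?g < x" "x < 1" for x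
  proof -
    obtain \<theta> where \<theta>: "0 \<le> \<theta>" "phi M D r \<theta> < x"
      using gamma_rate_less[OF x(1)] by auto
    have x0: "0 \<le> x"
      using gamma_rate_nonneg[of r] x by linarith
    have step: "p \<le> h * (?H s + x ^ Suc L / (1 - x))"
      if s: "r < s" "s < mean" and phi: "phi M D s \<theta> < x" for s
    proof -
      have hit: "hit_prob True k s \<le> x ^ k" for k
        using hit_prob_le_phi[OF \<theta>(1), of True k s] power_mono[OF less_imp_le[OF phi] phi_nonneg, of k] by simp
      have "\<mu> N s \<le> F + (s - r) * (?H s + x ^ Suc L / (1 - x))" for N
      proof -
        define K where "K = max N L"
        have "(\<Sum>k=1..K. hit_prob True k s) = ?H s + (\<Sum>k=Suc L..K. hit_prob True k s)"
          by (rule sum_split) (simp add: K_def)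
        also have "(\<Sum>k=Suc L..K. hit_prob True k s) \<le> (\<Sum>k=Suc L..K. x ^ k)"
          by (intro sum_mono hit)
        also have "\<dots> \<le> x ^ Suc L / (1 - x)"
          by (rule sum_power_tail_le[OF x0 x(2)])
        finally have "(s - r) * (\<Sum>k=1..K. hit_prob True k s) \<le> (s - r) * (?H s + x ^ Suc L / (1 - x))"
          using s by (intro mult_left_mono) auto
        moreover have "\<mu> K s - \<mu> K r \<le> (s - r) * (\<Sum>k=1..K. hit_prob True k s)"
          using s by (intro \<mu>_diff) auto
        moreover have "\<mu> N s \<le> \<mu> K s"
          by (rule \<mu>_mono) (simp add: K_def)
        ultimately show ?thesis
          using \<mu>_le_F[of K] by linarith
      qed
      then have "h * F + p * (mean - r) \<le> h * (F + (s - r) * (?H s + x ^ Suc L / (1 - x))) + p * (mean - s)"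
        using s r by (intro F_comparison) auto
      then have "(s - r) * p \<le> (s - r) * (h * (?H s + x ^ Suc L / (1 - x)))"
        by (simp add: algebra_simps)
      then show ?thesis
        using s by simp
    qed
    \<comment> \<open>The denominator starts at 2, which keeps every \<open>s n\<close> strictly
      below \<open>mean\<close>.\<close>
    define s where "s n = r + (mean - r) / real (Suc (Suc n))" for n
    have "s \<longlonglongrightarrow> r + 0"
      unfolding s_def[abs_def]
      by (intro tendsto_intros LIMSEQ_Suc[OF LIMSEQ_Suc[OF lim_const_over_n]])
    then have s: "s \<longlonglongrightarrow> r"
      by simp
    have "r \<le> s n" for n
      using r by (simp add: s_def)
    then have lim: "(\<lambda>n. h * (?H (s n) + x ^ Suc L / (1 - x))) \<longlonglongrightarrow> h * (?H r + x ^ Suc L / (1 - x))"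
      by (intro tendsto_add tendsto_mult tendsto_sum tendsto_const hit_prob_tendsto[OF s]) simp
    have "(\<lambda>n. exp (\<theta> * (s n - r)) * phi M D r \<theta>) \<longlonglongrightarrow> exp (\<theta> * (r - r)) * phi M D r \<theta>"
      by (intro tendsto_intros s)
    then have "(\<lambda>n. phi M D (s n) \<theta>) \<longlonglongrightarrow> phi M D r \<theta>"
      unfolding phi_shift[of _ \<theta> r, symmetric] by simp
    then have "\<forall>\<^sub>F n in sequentially. phi M D (s n) \<theta> < x"
      using \<theta>(2) by (rule order_tendstoD)
    then have "\<forall>\<^sub>F n in sequentially. p \<le> h * (?H (s n) + x ^ Suc L / (1 - x))"
    proof eventually_elim
      case (elim n)
      show ?case
      proof (rule step[OF _ _ elim])
        show "r < s n"
          using r by (simp add: s_def)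
        have "(mean - r) / real (Suc (Suc n)) < (mean - r) / 1"
          using r by (intro divide_strict_left_mono) auto
        then show "s n < mean"
          by (simp add: s_def)
      qed
    qed
    then show ?thesis
      using lim by (intro tendsto_lowerbound[OF lim]) auto
  qed
  have "((\<lambda>x. h * (?H r + x ^ Suc L / (1 - x))) \<longlongrightarrow> h * (?H r + ?g ^ Suc L / (1 - ?g))) (at_right ?g)"
    using assms by (intro tendsto_intros) auto
  moreover have "\<forall>\<^sub>F x in at_right ?g. p \<le> h * (?H r + x ^ Suc L / (1 - x))"
    using bound assms by (auto simp: eventually_at_right)
  ultimately show ?thesis
    by (intro tendsto_lowerbound) auto
qed

text \<open>It remains to find \<open>v\<close> whose slope \<open>h * Q\<close> is at most
  \<open>p\<close> but falls short of it by at most \<open>h * \<delta>\<close>, with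
  \<open>\<delta>\<close> the geometric tail.\<close>

lemma OPT_ge:
  assumes "gamma_rate M D r < 1" "0 < p"
  shows "ennreal (h * \<mu> L r + p * (mean - r) -
      h * (gamma_rate M D r ^ Suc L / (1 - gamma_rate M D r)) * (mean - r)) \<le> OPT M d h p L"
  unfolding OPT_def
proof (rule INF_greatest)
  fix f assume f: "f \<in> admissible L"
  let ?\<delta> = "gamma_rate M D r ^ Suc L / (1 - gamma_rate M D r)"
  let ?A = "\<Sum>k=1..L. hit_prob True k r"
  let ?B = "\<Sum>k=1..L. hit_prob False k r"
  have \<delta>: "0 \<le> ?\<delta>"
    using assms gamma_rate_nonneg by simp
  \<comment> \<open>If the weak sum does not overshoot \<open>p\<close>, the last maximizing index
    alone is used; otherwise \<open>p\<close> lies between the strict and the weak value, and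
    interpolation meets it exactly.\<close>
  obtain v where v: "0 \<le> v" "v \<le> 1" and le: "h * (v * ?A + (1 - v) * ?B) \<le> p"
    and ge: "p - h * ?\<delta> \<le> h * (v * ?A + (1 - v) * ?B)"
  proof (cases "h * ?A \<le> p")
    case True
    then show ?thesis
      using that[of 1] le_sum_hit_prob[OF assms(1)] by (simp add: algebra_simps)
  next
    case False
    define v where "v = (p - h * ?B) / (h * ?A - h * ?B)"
    have *: "h * ?B \<le> p" "p < h * ?A"
      using False sum_hit_prob_strict_le by auto
    then have v: "0 \<le> v" "v \<le> 1"
      by (auto simp: v_def divide_simps)
    have "h * ?A - h * ?B \<noteq> 0"
      using * by linarith
    then have "v * (h * ?A - h * ?B) = p - h * ?B"
      by (rule nonzero_eq_divide_eq[THEN iffD1, OF _ v_def])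
    then have "h * (v * ?A + (1 - v) * ?B) = p"
      by (simp add: algebra_simps)
    moreover have "0 \<le> h * ?\<delta>"
      by (rule mult_nonneg_nonneg[OF less_imp_le[OF hp(1)] \<delta>])
    ultimately show ?thesis
      using that[OF v] by linarith
  qed
  define Q where "Q = v * ?A + (1 - v) * ?B"
  have "(p - h * ?\<delta>) * (mean - r) \<le> h * Q * (mean - r)"
    using ge r unfolding Q_def by (intro mult_right_mono) auto
  then have "ennreal (h * \<mu> L r + p * (mean - r) - h * ?\<delta> * (mean - r))
      \<le> ennreal (h * \<mu> L r + h * Q * (mean - r))"
    by (intro ennreal_leI) (simp add: algebra_simps)
  also have "\<dots> \<le> average_cost M d h p L f"
    using le unfolding Q_def[symmetric]
    by (intro average_cost_ge[OF f hp(1) assms(2) L v Q_def])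
  finally show "ennreal (h * \<mu> L r + p * (mean - r) - h * ?\<delta> * (mean - r)) \<le> average_cost M d h p L f" .
qed

text \<open>An empty set of minimizers means \<open>vartheta_rate = \<infinity>\<close>, and then the right-hand side is \<open>0\<close>.\<close>

lemma F_tail_le:
  assumes "gamma_rate M D r < 1"
  shows "ennreal (F - \<mu> L r) \<le> ennreal (gamma_rate M D r ^ Suc L / (1 - gamma_rate M D r)) *
    inverse (ennreal (exp 1) * vartheta_rate M D r * of_nat (Suc L))"
proof (cases "phi_minimizers M D r = {}")
  case True
  then have "F \<le> \<mu> L r"
    by (intro F_le \<mu>_tail_unattained)
  then show ?thesis
    by (simp add: ennreal_neg)
next
  case False
  let ?g = "gamma_rate M D r"
  let ?\<delta> = "?g ^ Suc L / (1 - ?g)"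
  let ?c = "ennreal (exp 1) * of_nat (Suc L)"
  let ?t = "ennreal (F - \<mu> L r)"
  have \<delta>: "0 \<le> ?\<delta>"
    using assms gamma_rate_nonneg by simp
  \<comment> \<open>Kept in product form, so that the supremum over the minimizers can be pulled
    through the multiplication. A minimizer is positive because \<open>phi\<close> is 1 at 0 and
    \<open>\<gamma> < 1\<close>.\<close>
  have tail: "?t * ennreal \<theta> * ?c \<le> ennreal ?\<delta>" and pos: "0 < \<theta>" if \<theta>: "\<theta> \<in> phi_minimizers M D r" for \<theta>
  proof -
    have phi: "phi M D r \<theta> = ?g" and nonneg: "0 \<le> \<theta>"
      using phi_minimizer[OF \<theta>] by auto
    have "\<theta> \<noteq> 0"
      using phi assms by (auto simp: phi_0)
    then show pos: "0 < \<theta>"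
      using nonneg by simp
    have "F \<le> \<mu> L r + ?\<delta> / (exp 1 * \<theta> * real (Suc L))"
      using \<mu>_tail_le[OF pos, of r _ L] phi assms by (intro F_le) simp
    then have "F - \<mu> L r \<le> ?\<delta> / (exp 1 * \<theta> * real (Suc L))"
      by simp
    moreover have "0 < exp 1 * \<theta> * real (Suc L)"
      using pos by simp
    ultimately have "(F - \<mu> L r) * (exp 1 * \<theta> * real (Suc L)) \<le> ?\<delta>"
      by (simp only: pos_le_divide_eq)
    then have "(F - \<mu> L r) * \<theta> * (exp 1 * real (Suc L)) \<le> ?\<delta>"
      by (simp only: mult_ac)
    then show "?t * ennreal \<theta> * ?c \<le> ennreal ?\<delta>"
      using \<mu>_le_F[of L] pos
      by (simp add: ennreal_of_nat_eq_real_of_nat ennreal_mult'[symmetric] ennreal_mult[symmetric] ennreal_leI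
          del: of_nat_Suc)
  qed
  have v: "vartheta_rate M D r = (SUP \<theta>\<in>phi_minimizers M D r. ennreal \<theta>)"
    using False by (simp add: vartheta_rate_def)
  have v_pos: "vartheta_rate M D r \<noteq> 0"
  proof -
    obtain \<theta> where \<theta>: "\<theta> \<in> phi_minimizers M D r"
      using False by auto
    then have "ennreal \<theta> \<le> vartheta_rate M D r"
      unfolding v by (rule SUP_upper)
    then show ?thesis
      using pos[OF \<theta>] by auto
  qed
  have "?t * vartheta_rate M D r * ?c = (SUP \<theta>\<in>phi_minimizers M D r. ?t * ennreal \<theta> * ?c)"
    unfolding v using False by (simp add: SUP_mult_left_ennreal SUP_mult_right_ennreal)
  also have "\<dots> \<le> ennreal ?\<delta>"
    by (rule SUP_least) (rule tail)
  finally have le: "?t * (?c * vartheta_rate M D r) \<le> ennreal ?\<delta>"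
    by (simp add: mult_ac)
  show ?thesis
  proof (cases "vartheta_rate M D r = \<infinity>")
    case True
    have "?t = 0"
    proof (rule ccontr)
      assume "?t \<noteq> 0"
      then have "?t * (?c * vartheta_rate M D r) = \<infinity>"
        by (simp add: True ennreal_mult_top ennreal_mult_eq_top_iff)
      with le show False
        by (simp add: top_unique)
    qed
    then show ?thesis
      by simp
  next
    case fin: False
    have c: "?c * vartheta_rate M D r \<noteq> 0" "?c * vartheta_rate M D r \<noteq> \<infinity>"
      using v_pos fin by (auto simp: ennreal_mult_eq_top_iff)
    have "(?c * vartheta_rate M D r) * inverse (?c * vartheta_rate M D r) = 1"
      unfolding divide_ennreal_def[symmetric]
      using c by (intro ennreal_divide_self) (simp_all only: infinity_ennreal_def less_top not_False_eq_True)
    then have "?t = ?t * (?c * vartheta_rate M D r) * inverse (?c * vartheta_rate M D r)"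
      by (simp only: mult.assoc mult_1_right)
    also have "\<dots> \<le> ennreal ?\<delta> * inverse (?c * vartheta_rate M D r)"
      using le by (rule mult_right_mono) simp
    finally show ?thesis
      by (simp add: mult_ac)
  qed
qed

end

section \<open>From the additive gap to the ratio\<close>

text \<open>The cost is at least \<open>min h p\<close> times the distance of \<open>x\<close> to
  the demand. With \<open>a = E |D - mean|\<close>, Jensen's and the triangle inequality give
  \<open>a \<le> 2 * E |x - D|\<close>, whence \<open>a / 2\<close>.\<close>

lemma newsvendor_opt_pos:
  assumes "0 < h" "0 < p" and nondeg: "\<not> (AE \<omega> in M. D \<omega> = mean)"
  shows "0 < newsvendor_opt M D h p"
proof -
  define c where "c = min h p"
  define a where "a = expectation (\<lambda>\<omega>. \<bar>D \<omega> - mean\<bar>)"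
  have c: "0 < c" "c \<le> h" "c \<le> p"
    using assms by (auto simp: c_def)
  have int: "integrable M (\<lambda>\<omega>. \<bar>x - D \<omega>\<bar>)" "integrable M (\<lambda>\<omega>. \<bar>D \<omega> - x\<bar>)" for x
    using D_integrable by auto
  have "a \<noteq> 0"
    using integral_nonneg_eq_0_iff_AE[OF int(2)[of mean]] nondeg by (auto simp: a_def)
  then have a: "0 < a"
    unfolding a_def by (simp add: less_le)
  have "c * (a / 2) \<le> newsvendor_opt M D h p"
    unfolding newsvendor_opt_def
  proof (rule cINF_greatest)
    fix x
    have "\<bar>expectation (\<lambda>\<omega>. x - D \<omega>)\<bar> \<le> expectation (\<lambda>\<omega>. \<bar>x - D \<omega>\<bar>)"
      by (rule integral_abs_bound)
    moreover have "expectation (\<lambda>\<omega>. x - D \<omega>) = x - mean"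
      using D_integrable by (simp add: mean_def prob_space)
    moreover have "a \<le> expectation (\<lambda>\<omega>. \<bar>x - D \<omega>\<bar> + \<bar>x - mean\<bar>)"
      unfolding a_def using int by (intro integral_mono) auto
    moreover have "expectation (\<lambda>\<omega>. \<bar>x - D \<omega>\<bar> + \<bar>x - mean\<bar>) = expectation (\<lambda>\<omega>. \<bar>x - D \<omega>\<bar>) + \<bar>x - mean\<bar>"
      using int by (simp add: prob_space)
    ultimately have "a / 2 \<le> expectation (\<lambda>\<omega>. \<bar>x - D \<omega>\<bar>)"
      by simp
    then have "c * (a / 2) \<le> c * expectation (\<lambda>\<omega>. \<bar>x - D \<omega>\<bar>)"
      using c by (intro mult_left_mono) auto
    also have "\<dots> = expectation (\<lambda>\<omega>. c * \<bar>x - D \<omega>\<bar>)"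
      by simp
    also have "\<dots> \<le> expectation (\<lambda>\<omega>. newsvendor_cost h p (x - D \<omega>))"
    proof (intro integral_mono integrable_newsvendor_cost)
      show "integrable M (\<lambda>\<omega>. c * \<bar>x - D \<omega>\<bar>)"
        using int by simp
      fix \<omega>
      have "c * y \<le> h * y" "c * y \<le> p * y" if "0 \<le> y" for y
        using c that by (auto intro: mult_right_mono)
      from this[of "\<bar>x - D \<omega>\<bar>"] show "c * \<bar>x - D \<omega>\<bar> \<le> newsvendor_cost h p (x - D \<omega>)"
        by (auto simp: newsvendor_cost_def max_def abs_if split: if_splits)
    qed
    finally show "c * (a / 2) \<le> expectation (\<lambda>\<omega>. newsvendor_cost h p (x - D \<omega>))" .
  qed simp
  moreover have "0 < c * (a / 2)"
    using a c by simp
  ultimately show ?thesis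
    by linarith
qed

lemma constant_order_gap:
  assumes "0 < h" "0 < p" "1 \<le> L" and nondeg: "\<not> (AE \<omega> in M. D \<omega> = mean)"
  defines "r \<equiv> r_inf M d h p L mean" and "g \<equiv> newsvendor_opt M D h p"
  shows "average_cost M d h p L (constant_order r) / OPT M d h p L
    \<le> 1 + ennreal h * inverse (ennreal ((1 - gamma_rate M D r) * g))
      * (ennreal (mean - r) + inverse (ennreal (exp 1) * vartheta_rate M D r * of_nat (L + 1)))
      * ennreal (gamma_rate M D r ^ (L + 1))"
proof -
  let ?\<gamma> = "gamma_rate M D r"
  let ?i = "inverse (ennreal (exp 1) * vartheta_rate M D r * of_nat (L + 1))"
  let ?C = "average_cost M d h p L (constant_order r)"
  let ?O = "OPT M d h p L"
  have p: "0 \<le> p"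
    using assms by simp
  note r_props = r_inf_minimizer[OF assms(1) p assms(3) nondeg, folded r_def]
  have g: "0 < g"
    unfolding g_def by (rule newsvendor_opt_pos[OF assms(1,2) nondeg])
  show ?thesis
  proof (cases "?\<gamma> < 1")
    case False
    \<comment> \<open>In this case the right-hand side is \<open>\<infinity>\<close>: it contains
      \<open>inverse 0\<close>, and the other factors are positive as
      \<open>r < mean\<close>.\<close>
    then have "?\<gamma> = 1"
      using gamma_rate_le_1[of r] by simp
    then show ?thesis
      using assms(1) r_props(2) by (simp add: ennreal_mult_top ennreal_top_mult)
  next
    case True
    define F where "F = (SUP N. \<mu> N r)"
    define \<delta> where "\<delta> = ?\<gamma> ^ Suc L / (1 - ?\<gamma>)"
    define E where "E = ennreal h * (ennreal \<delta> * (ennreal (mean - r) + ?i))"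
    have \<delta>: "0 \<le> \<delta>"
      using True gamma_rate_nonneg by (simp add: \<delta>_def)
    note ctx = assms(1) p assms(3) r_props
    have "?C \<le> ennreal (h * F + p * (mean - r))"
      unfolding F_def by (rule average_cost_r_le[OF ctx])
    \<comment> \<open>The lower bound on the optimum is separated from the slope error and the
      truncation error.\<close>
    also have "h * F + p * (mean - r) = (h * \<mu> L r + p * (mean - r) - h * \<delta> * (mean - r))
        + (h * (\<delta> * (mean - r)) + h * (F - \<mu> L r))"
      by (simp add: algebra_simps)
    also have "ennreal \<dots> \<le> ennreal (h * \<mu> L r + p * (mean - r) - h * \<delta> * (mean - r))
        + ennreal (h * (\<delta> * (mean - r)) + h * (F - \<mu> L r))"
      using \<mu>_le_F[OF ctx, of L, folded F_def] \<delta> r_props(2) assms(1)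
      by (intro ennreal_add_le add_nonneg_nonneg mult_nonneg_nonneg) auto
    also have "\<dots> \<le> ?O + ennreal (h * (\<delta> * (mean - r)) + h * (F - \<mu> L r))"
      unfolding \<delta>_def by (intro add_right_mono OPT_ge[OF ctx True assms(2)])
    also have "ennreal (h * (\<delta> * (mean - r)) + h * (F - \<mu> L r))
        = ennreal h * (ennreal \<delta> * ennreal (mean - r) + ennreal (F - \<mu> L r))"
    proof -
      have "0 \<le> F - \<mu> L r" "0 \<le> mean - r"
        using \<mu>_le_F[OF ctx, of L, folded F_def] r_props(2) by auto
      then show ?thesis
        using \<delta> assms(1) by (simp add: ennreal_mult distrib_left)
    qed
    also have "\<dots> \<le> E"
      unfolding E_def distrib_left[of "ennreal \<delta>"]
      using F_tail_le[OF ctx True, folded F_def \<delta>_def] by (intro mult_left_mono add_left_mono) auto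
    finally have C: "?C \<le> ?O + E"
      by (simp add: add_left_mono)
    have O: "ennreal g \<le> ?O"
      unfolding OPT_def g_def using assms(1-3)
      by (intro INF_greatest newsvendor_opt_le_average_cost) auto
    have "?C / ?O \<le> (?O + E) / ?O"
      by (rule divide_right_mono_ennreal[OF C])
    also have "\<dots> = ?O / ?O + E / ?O"
      by (simp add: divide_ennreal_def distrib_right)
    also have "\<dots> \<le> 1 + E * inverse (ennreal g)"
    proof (rule add_mono)
      \<comment> \<open>Not an equality in general: extended reals have
        \<open>\<infinity> / \<infinity> = 0\<close>.\<close>
      show "?O / ?O \<le> 1"
      proof (cases "?O = \<infinity>")
        case False
        moreover have "?O \<noteq> 0"
          using g O by auto
        ultimately have "?O / ?O = 1"
          by (intro ennreal_divide_self) (simp_all add: less_top)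
        then show ?thesis
          by simp
      qed simp
      show "E / ?O \<le> E * inverse (ennreal g)"
        unfolding divide_ennreal_def
      proof (intro mult_left_mono)
        show "inverse ?O \<le> inverse (ennreal g)"
        proof (cases ?O)
          case (real o')
          then have "g \<le> o'"
            using O by simp
          then have "inverse o' \<le> inverse g" "0 < o'"
            using g by (auto intro: le_imp_inverse_le)
          then show ?thesis
            unfolding real(2) using g by (simp only: inverse_ennreal ennreal_leI)
        qed simp
      qed simp
    qed
    also have "E * inverse (ennreal g) = ennreal h * inverse (ennreal ((1 - ?\<gamma>) * g))
        * (ennreal (mean - r) + ?i) * ennreal (?\<gamma> ^ (L + 1))"
    proof -
      let ?j = "inverse (ennreal ((1 - ?\<gamma>) * g))" and ?s = "ennreal (mean - r) + ?i"
      have "0 < (1 - ?\<gamma>) * g"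
        using True g by (intro mult_pos_pos) auto
      then have "?j = ennreal (inverse ((1 - ?\<gamma>) * g))" and "0 \<le> inverse ((1 - ?\<gamma>) * g)"
        by (simp_all only: inverse_ennreal inverse_nonnegative_iff_nonnegative less_imp_le)
      then have "?j * ennreal (?\<gamma> ^ (L + 1)) = ennreal (inverse ((1 - ?\<gamma>) * g) * ?\<gamma> ^ (L + 1))"
        using gamma_rate_nonneg[of r] by (simp only: ennreal_mult zero_le_power)
      also have "inverse ((1 - ?\<gamma>) * g) * ?\<gamma> ^ (L + 1) = \<delta> * inverse g"
        by (simp only: \<delta>_def divide_inverse inverse_mult_distrib Suc_eq_plus1 mult_ac)
      also have "ennreal (\<delta> * inverse g) = ennreal \<delta> * inverse (ennreal g)"
        using g \<delta> by (subst ennreal_mult) (auto simp: inverse_ennreal)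
      finally have *: "ennreal \<delta> * inverse (ennreal g) = ?j * ennreal (?\<gamma> ^ (L + 1))" ..
      have "E * inverse (ennreal g) = ennreal h * (ennreal \<delta> * inverse (ennreal g)) * ?s"
        unfolding E_def by (simp only: mult_ac)
      also have "\<dots> = ennreal h * ?j * ?s * ennreal (?\<gamma> ^ (L + 1))"
        unfolding * by (simp only: mult_ac)
      finally show ?thesis .
    qed
    finally show ?thesis .
  qed
qed

end

theorem theorem1:
  fixes M :: "'a measure" and D :: "'a \<Rightarrow> real" and d :: "nat \<Rightarrow> 'a \<Rightarrow> real"
    and h p :: real and L :: nat
  assumes "prob_space M"
    and "D \<in> borel_measurable M"
    and "AE \<omega> in M. 0 \<le> D \<omega>"
    and "integrable M D"
    and "0 < (\<integral>\<^sup>+\<omega>. ennreal ((D \<omega> - (\<integral>\<omega>'. D \<omega>' \<partial>M))\<^sup>2) \<partial>M)"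
    and "prob_space.indep_vars M (\<lambda>_. borel) d {1..}"
    and "\<And>t. 1 \<le> t \<Longrightarrow> distr M borel (d t) = distr M borel D"
    and "0 < h" and "0 < p" and "1 \<le> L"
  shows "let m = (\<integral>\<omega>. D \<omega> \<partial>M);
             r = r_inf M d h p L m;
             \<gamma> = gamma_rate M D r;
             \<theta> = vartheta_rate M D r;
             g = newsvendor_opt M D h p
         in average_cost M d h p L (constant_order r) / OPT M d h p L
              \<le> 1 + ennreal h * inverse (ennreal ((1 - \<gamma>) * g))
                    * (ennreal (m - r) + inverse (ennreal (exp 1) * \<theta> * of_nat (L + 1)))
                    * ennreal (\<gamma> ^ (L + 1))"
proof -
  interpret prob_space M
    by fact
  interpret iid_demand M D d
    by unfold_locales fact+
  \<comment> \<open>All that is used of the variance is that the demand is not almost surely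
    constant; the variance itself may be infinite.\<close>
  have "\<not> (AE \<omega> in M. D \<omega> = mean)"
  proof
    assume "AE \<omega> in M. D \<omega> = mean"
    then have "AE \<omega> in M. ennreal ((D \<omega> - mean)\<^sup>2) = 0"
      by eventually_elim simp
    then have "(\<integral>\<^sup>+\<omega>. ennreal ((D \<omega> - mean)\<^sup>2) \<partial>M) = 0"
      by (subst nn_integral_0_iff_AE) auto
    with assms(5) show False
      by (simp add: mean_def)
  qed
  from constant_order_gap[OF assms(8-10) this] show ?thesis
    by (simp only: Let_def mean_def)
qed

end
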